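(* For every $n$ and every formula $\varphi$ with $\textsf{AtMostOne}(x_1,\dots,x_n) \Rightarrow^{*}_{\mathrm{BVA}} \varphi$, we have $|\varphi| \ge 3n-6$.
   Context: A literal is a variable $x$ or its negation $\overline{x}$. A clause is a set of non-complementary literals, a formula is a set of clauses, and $|\varphi|$ is the number of clauses; $\textsf{Var}(\varphi)$ is the set of variables of $\varphi$. $\textsf{AtMostOne}(x_1,\dots,x_n) := \bigwedge_{1\le i<j\le n}(\overline{x_i}\lor\overline{x_j})$. BVA step: let $\varphi$ be a formula, let $\mathcal{C},\mathcal{D}$ be sets of nonempty clauses such that $\mathcal{C}\bowtie\mathcal{D} := \{C\cup D : C\in\mathcal{C}, D\in\mathcal{D}\}\subseteq\varphi$, and let $y\notin\textsf{Var}(\varphi)$ be fresh. Then $\varphi' := (\varphi\setminus(\mathcal{C}\bowtie\mathcal{D}))\cup\{C\cup\{y\} : C\in\mathcal{C}\}\cup\{\{\overline{y}\}\cup D : D\in\mathcal{D}\}$ is derived in one BVA step, written $\varphi\Rightarrow_{\mathrm{BVA}}\varphi'$; $\Rightarrow^{*}_{\mathrm{BVA}}$ is the reflexive transitive closure of $\Rightarrow_{\mathrm{BVA}}$. *)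

theory Defs
  imports Main
begin

datatype 'v literal = Pos 'v | Neg 'v

fun var_of :: "'v literal \<Rightarrow> 'v" where
  "var_of (Pos v) = v"
| "var_of (Neg v) = v"

definition is_clause :: "'v literal set \<Rightarrow> bool" where
  "is_clause C \<longleftrightarrow> finite C \<and> \<not> (\<exists>v. Pos v \<in> C \<and> Neg v \<in> C)"

definition is_formula :: "'v literal set set \<Rightarrow> bool" where
  "is_formula \<phi> \<longleftrightarrow> finite \<phi> \<and> (\<forall>C\<in>\<phi>. is_clause C)"

definition Var :: "'v literal set set \<Rightarrow> 'v set" where
  "Var \<phi> = var_of ` \<Union>\<phi>"

definition AtMostOne :: "(nat \<Rightarrow> 'v) \<Rightarrow> nat \<Rightarrow> 'v literal set set" where
  "AtMostOne x n = {{Neg (x i), Neg (x j)} | i j. 1 \<le> i \<and> i < j \<and> j \<le> n}"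

definition clause_join ::
  "'v literal set set \<Rightarrow> 'v literal set set \<Rightarrow> 'v literal set set" (infixl "\<bowtie>" 70) where
  "\<C> \<bowtie> \<D> = {C \<union> D | C D. C \<in> \<C> \<and> D \<in> \<D>}"

definition bva_step :: "'v literal set set \<Rightarrow> 'v literal set set \<Rightarrow> bool"
    (infix "\<Rightarrow>\<^sub>B\<^sub>V\<^sub>A" 50) where
  "\<phi> \<Rightarrow>\<^sub>B\<^sub>V\<^sub>A \<phi>' \<longleftrightarrow> is_formula \<phi> \<and>
    (\<exists>\<C> \<D> y.
      (\<forall>C\<in>\<C>. is_clause C \<and> C \<noteq> {}) \<and>
      (\<forall>D\<in>\<D>. is_clause D \<and> D \<noteq> {}) \<and>
      \<C> \<bowtie> \<D> \<subseteq> \<phi> \<and>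
      y \<notin> Var \<phi> \<and>
      \<phi>' = (\<phi> - (\<C> \<bowtie> \<D>)) \<union> {C \<union> {Pos y} | C. C \<in> \<C>} \<union> {{Neg y} \<union> D | D. D \<in> \<D>})"

abbreviation bva_steps :: "'v literal set set \<Rightarrow> 'v literal set set \<Rightarrow> bool"
    (infix "\<Rightarrow>\<^sup>*\<^sub>B\<^sub>V\<^sub>A" 50) where
  "\<phi> \<Rightarrow>\<^sup>*\<^sub>B\<^sub>V\<^sub>A \<phi>' \<equiv> bva_step\<^sup>*\<^sup>* \<phi> \<phi>'"

end

theory Submission
  imports Defs Complex_Main
begin

text \<open>
  View clauses as sets of vertices (literals), so that \<open>AtMostOne\<close> is a complete graph. To a
  graph \<open>E\<close> with a set \<open>P\<close> of pairs \<open>{u, v}\<close> of fresh vertices assign the quadratic form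
  \<open>\<Sum>{x y. {x, y} \<in> E} - \<Sum>{u v. {u, v} \<in> P}\<close>. As in the theorem of Graham and Pollak, a step that
  replaces a complete bipartite graph by two stars with centres \<open>u\<close> and \<open>v\<close> adds a hyperbolic
  plane, so it adds 1 to the dimension \<open>d\<close> of a negative definite subspace and 2 to the number of
  vertices, and \<open>b = 3 (2 d - card V)\<close> does not change. For the complete graph \<open>b = 3 n - 6\<close>.
  Deleting a vertex lowers \<open>b\<close> by at most 3, so in a minimal counterexample to \<open>card \<phi> \<ge> b\<close> no
  vertex lies in three final clauses; for a derivation of length 0 this forces all vertices to be
  paired, and then \<open>b \<le> 0\<close>.

  Steps with overlapping \<open>C\<close> and \<open>D\<close> lead to larger clauses. On a graph such a step either has a
  vertex \<open>a\<close> in all of \<open>\<C>\<close> (or all of \<open>\<D>\<close>), and then, since few final clauses contain \<open>a\<close>, it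
  can be left out; or it has \<open>\<C> = {{a}, {b}}\<close> and \<open>{a, b} \<in> \<D>\<close>, and then it can be replaced by
  the bipartite step in which \<open>{a, b}\<close> is kept as a clause of its own.
\<close>

section \<open>Steps on families of sets\<close>

text \<open>Only the start of a derivation has to be a graph. The bound is claimed for every graph
  with pairs and every derivation from it, so that an induction can move the start past a bipartite
  first step. Later families may have clauses of any size and carry no quadratic form; the only
  control over them is how a change at the start acts on the end: deleting vertices, following one
  vertex of a clause into a final clause, or merging two vertices.

  The factor 3 in the bound is the number of final clauses that pay for one deleted vertex: the
  deletion costs at most one dimension and exactly one element of \<open>V\<close>, so
  \<open>2 d - card V\<close> falls by at most 1. Vertices that become isolated along the way can be
  deleted without loss of dimension and even raise the bound; the arguments with two deleted
  vertices and three lost clauses rest on this.\<close>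

definition joins :: "'a set set \<Rightarrow> 'a set set \<Rightarrow> 'a set set" where
  "joins \<C> \<D> = {C \<union> D | C D. C \<in> \<C> \<and> D \<in> \<D>}"

text \<open>The vertices \<open>u\<close> and \<open>v\<close> stand for a fresh literal and its
  complement. Forgetting that they are complementary makes a step symmetric under exchanging
  (\<open>\<C>\<close>, \<open>u\<close>) with (\<open>\<D>\<close>, \<open>v\<close>).\<close>

definition split_by :: "'a set set \<Rightarrow> 'a set set \<Rightarrow> 'a set set \<Rightarrow> 'a \<Rightarrow> 'a \<Rightarrow> 'a set set" where
  "split_by \<phi> \<C> \<D> u v = (\<phi> - joins \<C> \<D>) \<union> insert u ` \<C> \<union> insert v ` \<D>"

text \<open>\<open>W\<close> collects the vertices that count as used, so freshness does not depend
  on the clauses still present. Nonemptiness of both sides puts every clause of \<open>\<C>\<close>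
  and \<open>\<D>\<close> inside a clause of \<open>\<phi>\<close>, hence over old vertices.\<close>

definition splittable ::
  "'a set \<Rightarrow> 'a set set \<Rightarrow> 'a set set \<Rightarrow> 'a set set \<Rightarrow> 'a \<Rightarrow> 'a \<Rightarrow> bool" where
  "splittable W \<phi> \<C> \<D> u v \<longleftrightarrow> \<C> \<noteq> {} \<and> \<D> \<noteq> {} \<and> {} \<notin> \<C> \<and> {} \<notin> \<D> \<and>
     joins \<C> \<D> \<subseteq> \<phi> \<and> u \<notin> W \<and> v \<notin> W \<and> u \<noteq> v"

definition step :: "'a set \<times> 'a set set \<Rightarrow> 'a set \<times> 'a set set \<Rightarrow> bool" where
  "step s t \<longleftrightarrow> (\<exists>\<C> \<D> u v. splittable (fst s) (snd s) \<C> \<D> u v \<and>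
     t = (fst s \<union> {u, v}, split_by (snd s) \<C> \<D> u v))"

lemma stepI: "splittable W \<phi> \<C> \<D> u v \<Longrightarrow> step (W, \<phi>) (W \<union> {u, v}, split_by \<phi> \<C> \<D> u v)"
  unfolding step_def by auto

lemma stepE:
  assumes "step (W, \<phi>) t"
  obtains \<C> \<D> u v where "splittable W \<phi> \<C> \<D> u v" "t = (W \<union> {u, v}, split_by \<phi> \<C> \<D> u v)"
  using assms unfolding step_def by auto

lemma joins_commute: "joins \<C> \<D> = joins \<D> \<C>"
  unfolding joins_def by blast

lemma splittable_commute: "splittable W \<phi> \<C> \<D> u v \<longleftrightarrow> splittable W \<phi> \<D> \<C> v u"
  unfolding splittable_def joins_commute[of \<C>] by blast

lemma split_by_commute: "split_by \<phi> \<C> \<D> u v = split_by \<phi> \<D> \<C> v u"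
  unfolding split_by_def joins_commute[of \<C>] by blast

lemma joinsI: "C \<in> \<C> \<Longrightarrow> D \<in> \<D> \<Longrightarrow> C \<union> D \<in> joins \<C> \<D>"
  unfolding joins_def by blast

lemma splittable_Un: "splittable W \<phi> \<C> \<D> u v \<Longrightarrow> C \<in> \<C> \<Longrightarrow> D \<in> \<D> \<Longrightarrow> C \<union> D \<in> \<phi>"
  unfolding splittable_def using joinsI by blast

lemma splittable_subset:
  assumes "splittable W \<phi> \<C> \<D> u v" "\<Union>\<phi> \<subseteq> W"
  shows "\<Union>\<C> \<subseteq> W" "\<Union>\<D> \<subseteq> W"
proof -
  obtain C0 D0 where 0: "C0 \<in> \<C>" "D0 \<in> \<D>" using assms(1) unfolding splittable_def by blast
  show "\<Union>\<C> \<subseteq> W" using splittable_Un[OF assms(1) _ 0(2)] assms(2) by blast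
  show "\<Union>\<D> \<subseteq> W" using splittable_Un[OF assms(1) 0(1)] assms(2) by blast
qed

lemma steps_subset:
  assumes "(step ^^ n) (W, \<phi>) (W', \<phi>')" "\<Union>\<phi> \<subseteq> W"
  shows "W \<subseteq> W' \<and> \<Union>\<phi>' \<subseteq> W'"
  using assms
proof (induction n arbitrary: W' \<phi>')
  case (Suc n)
  then obtain W1 \<phi>1 where 1: "(step ^^ n) (W, \<phi>) (W1, \<phi>1)" "step (W1, \<phi>1) (W', \<phi>')"
    by auto
  from 1(2) obtain \<C> \<D> u v where s: "splittable W1 \<phi>1 \<C> \<D> u v"
    and t: "W' = W1 \<union> {u, v}" "\<phi>' = split_by \<phi>1 \<C> \<D> u v" by (auto elim: stepE)
  have *: "W \<subseteq> W1" "\<Union>\<phi>1 \<subseteq> W1" using Suc.IH[OF 1(1)] Suc.prems(2) by auto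
  have "\<Union>(split_by \<phi>1 \<C> \<D> u v) \<subseteq> W1 \<union> {u, v}"
    using splittable_subset[OF s *(2)] *(2) unfolding split_by_def by blast
  then show ?case using * unfolding t by blast
qed auto

lemma steps_weaken:
  assumes "(step ^^ n) (W, \<phi>) (W', \<phi>')" "V \<subseteq> W"
  shows "\<exists>V'\<subseteq>W'. (step ^^ n) (V, \<phi>) (V', \<phi>')"
  using assms
proof (induction n arbitrary: W' \<phi>')
  case (Suc n)
  then obtain W1 \<phi>1 where 1: "(step ^^ n) (W, \<phi>) (W1, \<phi>1)" "step (W1, \<phi>1) (W', \<phi>')"
    by auto
  from 1(2) obtain \<C> \<D> u v where s: "splittable W1 \<phi>1 \<C> \<D> u v"
    and t: "W' = W1 \<union> {u, v}" "\<phi>' = split_by \<phi>1 \<C> \<D> u v" by (auto elim: stepE)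
  obtain V1 where V1: "V1 \<subseteq> W1" "(step ^^ n) (V, \<phi>) (V1, \<phi>1)"
    using Suc.IH[OF 1(1)] Suc.prems(2) by auto
  have "splittable V1 \<phi>1 \<C> \<D> u v" using s V1(1) unfolding splittable_def by blast
  from stepI[OF this] V1(2) have "(step ^^ Suc n) (V, \<phi>) (V1 \<union> {u, v}, \<phi>')"
    unfolding t by auto
  moreover have "V1 \<union> {u, v} \<subseteq> W'" using V1(1) t(1) by auto
  ultimately show ?case by (intro exI[of _ "V1 \<union> {u, v}"] conjI)
qed auto

section \<open>Deleting vertices\<close>

definition avoid :: "'a set \<Rightarrow> 'a set set \<Rightarrow> 'a set set" where
  "avoid L \<phi> = {K \<in> \<phi>. K \<inter> L = {}}"

lemma avoid_subset: "avoid L \<phi> \<subseteq> \<phi>"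
  unfolding avoid_def by blast

text \<open>Once a deletion empties one side, every join is deleted, and whatever the step adds
  contains \<open>u\<close> or \<open>v\<close>. Deleting these two as well makes the step
  vanish.\<close>

lemma avoid_split_by_degenerate:
  assumes "u \<notin> \<Union>\<phi>" "v \<notin> \<Union>\<phi>" "avoid L \<C> = {} \<or> avoid L \<D> = {}"
  shows "avoid (L \<union> {u, v}) (split_by \<phi> \<C> \<D> u v) = avoid L \<phi>"
proof -
  have "avoid L (joins \<C> \<D>) = {}" using assms(3) unfolding avoid_def joins_def by blast
  moreover have "avoid (L \<union> {u, v}) \<phi> = avoid L \<phi>" using assms(1,2) unfolding avoid_def by blast
  ultimately show ?thesis unfolding avoid_def split_by_def by blast
qed

lemma avoid_split_by:
  assumes "u \<notin> L" "v \<notin> L"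
  shows "avoid L (split_by \<phi> \<C> \<D> u v) = split_by (avoid L \<phi>) (avoid L \<C>) (avoid L \<D>) u v"
proof -
  have "avoid L (insert x ` \<A>) = insert x ` avoid L \<A>" if "x \<notin> L" for x \<A>
    using that unfolding avoid_def by blast
  moreover have "avoid L (joins \<C> \<D>) = joins (avoid L \<C>) (avoid L \<D>)"
    unfolding avoid_def joins_def by blast
  moreover have "avoid L (\<A> \<union> \<B>) = avoid L \<A> \<union> avoid L \<B>" "avoid L (\<A> - \<B>) = avoid L \<A> - avoid L \<B>"
    for \<A> \<B> unfolding avoid_def by blast+
  ultimately show ?thesis using assms unfolding split_by_def by simp
qed

lemma splittable_avoid:
  assumes "splittable W \<phi> \<C> \<D> u v" "avoid L \<C> \<noteq> {}" "avoid L \<D> \<noteq> {}"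
  shows "splittable W (avoid L \<phi>) (avoid L \<C>) (avoid L \<D>) u v"
  using assms unfolding splittable_def avoid_def joins_def by blast

text \<open>A deletion at the start follows the derivation: each step either survives with smaller
  sides or degenerates, and then its two new vertices join the deleted set. Hence \<open>L'\<close>
  may exceed \<open>L\<close>, and all final clauses meeting \<open>L'\<close> are lost.\<close>

lemma steps_avoid:
  assumes "(step ^^ n) (W, \<phi>) (W', \<phi>')" "\<Union>\<phi> \<subseteq> W" "L \<subseteq> W" "V \<subseteq> W"
  shows "\<exists>m\<le>n. \<exists>L' V'. L \<subseteq> L' \<and> L' \<subseteq> W' \<and> V' \<subseteq> W' \<and>
    (step ^^ m) (V, avoid L \<phi>) (V', avoid L' \<phi>')"
  using assms
proof (induction n arbitrary: W' \<phi>')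
  case 0
  then show ?case by auto
next
  case (Suc n)
  then obtain W1 \<phi>1 where 1: "(step ^^ n) (W, \<phi>) (W1, \<phi>1)" "step (W1, \<phi>1) (W', \<phi>')"
    by auto
  from 1(2) obtain \<C> \<D> u v where s: "splittable W1 \<phi>1 \<C> \<D> u v"
    and t: "W' = W1 \<union> {u, v}" "\<phi>' = split_by \<phi>1 \<C> \<D> u v" by (auto elim: stepE)
  have sub: "\<Union>\<phi>1 \<subseteq> W1" using steps_subset[OF 1(1) Suc.prems(2)] by blast
  obtain m L' V' where IH: "m \<le> n" "L \<subseteq> L'" "L' \<subseteq> W1" "V' \<subseteq> W1"
    "(step ^^ m) (V, avoid L \<phi>) (V', avoid L' \<phi>1)"
    using Suc.IH[OF 1(1) Suc.prems(2-4)] by blast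
  have uv: "u \<notin> W1" "v \<notin> W1" using s unfolding splittable_def by auto
  show ?case
  proof (cases "avoid L' \<C> = {} \<or> avoid L' \<D> = {}")
    case True
    have "avoid (L' \<union> {u, v}) \<phi>' = avoid L' \<phi>1"
      unfolding t using avoid_split_by_degenerate[OF _ _ True] sub uv by blast
    then have "m \<le> Suc n" "L \<subseteq> L' \<union> {u, v}" "L' \<union> {u, v} \<subseteq> W'" "V' \<subseteq> W'"
      "(step ^^ m) (V, avoid L \<phi>) (V', avoid (L' \<union> {u, v}) \<phi>')"
      using IH t(1) by auto
    then show ?thesis by blast
  next
    case False
    have "splittable W1 (avoid L' \<phi>1) (avoid L' \<C>) (avoid L' \<D>) u v"
      using splittable_avoid[OF s] False by blast
    then have "splittable V' (avoid L' \<phi>1) (avoid L' \<C>) (avoid L' \<D>) u v"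
      using IH(4) unfolding splittable_def by auto
    from stepI[OF this] have "step (V', avoid L' \<phi>1) (V' \<union> {u, v}, avoid L' \<phi>')"
      unfolding t using avoid_split_by[of u L' v] uv IH(3) by (simp add: subset_iff) metis
    then have "(step ^^ Suc m) (V, avoid L \<phi>) (V' \<union> {u, v}, avoid L' \<phi>')"
      using IH(5) by auto
    moreover have "Suc m \<le> Suc n" "L \<subseteq> L'" "L' \<subseteq> W'" "V' \<union> {u, v} \<subseteq> W'"
      using IH t(1) by auto
    ultimately show ?thesis by blast
  qed
qed

text \<open>Deleting \<open>a\<close> also deletes the two vertices added by a step all of whose \<open>\<C>\<close> contain
  \<open>a\<close>.\<close>

lemma steps_avoid_central:
  assumes "(step ^^ n) (W, \<phi>) (W1, \<phi>1)" "\<Union>\<phi> \<subseteq> W" "L \<subseteq> W"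
    and s: "splittable W1 \<phi>1 \<C> \<D> u v" and a: "a \<in> L" "\<forall>C\<in>\<C>. a \<in> C"
    and r: "(step ^^ k) (W1 \<union> {u, v}, split_by \<phi>1 \<C> \<D> u v) (W', \<phi>')"
    and V: "V \<subseteq> W"
  shows "\<exists>m\<le>n + k. \<exists>L' V'. L \<union> {u, v} \<subseteq> L' \<and>
    (step ^^ m) (V, avoid L \<phi>) (V', avoid L' \<phi>')"
proof -
  have sub: "\<Union>\<phi>1 \<subseteq> W1" using steps_subset[OF assms(1,2)] by blast
  obtain m L1 V1 where 1: "m \<le> n" "L \<subseteq> L1" "L1 \<subseteq> W1" "V1 \<subseteq> W1"
    "(step ^^ m) (V, avoid L \<phi>) (V1, avoid L1 \<phi>1)"
    using steps_avoid[OF assms(1-3) V] by blast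
  have uv: "u \<notin> W1" "v \<notin> W1" using s unfolding splittable_def by auto
  have "avoid L1 \<C> = {}" using a 1(2) unfolding avoid_def by blast
  then have eq: "avoid (L1 \<union> {u, v}) (split_by \<phi>1 \<C> \<D> u v) = avoid L1 \<phi>1"
    using avoid_split_by_degenerate[of u \<phi>1 v L1 \<C> \<D>] sub uv by blast
  have "\<Union>(split_by \<phi>1 \<C> \<D> u v) \<subseteq> W1 \<union> {u, v}"
    using splittable_subset[OF s sub] sub unfolding split_by_def by blast
  moreover have "L1 \<union> {u, v} \<subseteq> W1 \<union> {u, v}" "V1 \<subseteq> W1 \<union> {u, v}" using 1(3,4) by auto
  ultimately have "\<exists>m\<le>k. \<exists>L' V'. L1 \<union> {u, v} \<subseteq> L' \<and> L' \<subseteq> W' \<and> V' \<subseteq> W' \<and>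
    (step ^^ m) (V1, avoid L1 \<phi>1) (V', avoid L' \<phi>')"
    using steps_avoid[OF r, of "L1 \<union> {u, v}" V1] unfolding eq by blast
  then obtain m' L' V' where 2: "m' \<le> k" "L1 \<union> {u, v} \<subseteq> L'"
    "(step ^^ m') (V1, avoid L1 \<phi>1) (V', avoid L' \<phi>')"
    by blast
  have "(step ^^ (m + m')) (V, avoid L \<phi>) (V', avoid L' \<phi>')"
    using 1(5) 2(3) unfolding relpowp_add by blast
  moreover have "m + m' \<le> n + k" "L \<union> {u, v} \<subseteq> L'" using 1(1,2) 2(1,2) by auto
  ultimately show ?thesis by blast
qed

section \<open>Tracing clauses forward\<close>

text \<open>If \<open>K\<close> is replaced, \<open>x\<close> survives in one of its two halves,
  which on old vertices is smaller than \<open>K\<close>. Lower bounds on the number of final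
  clauses come from here: traces of different clauses are told apart by the old vertices they cannot
  contain.\<close>

lemma step_trace:
  assumes s: "splittable W \<phi> \<C> \<D> u v" and "\<Union>\<phi> \<subseteq> W" "K \<in> \<phi>" "x \<in> K"
  shows "\<exists>F\<in>split_by \<phi> \<C> \<D> u v. x \<in> F \<and> F \<inter> W \<subseteq> K"
proof (cases "K \<in> joins \<C> \<D>")
  case True
  then obtain C D where "C \<in> \<C>" "D \<in> \<D>" "K = C \<union> D" unfolding joins_def by blast
  moreover have "u \<notin> W" "v \<notin> W" using s unfolding splittable_def by auto
  ultimately have "insert u C \<in> split_by \<phi> \<C> \<D> u v" "insert u C \<inter> W \<subseteq> K"
    "insert v D \<in> split_by \<phi> \<C> \<D> u v" "insert v D \<inter> W \<subseteq> K" "x \<in> C \<or> x \<in> D"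
    using assms(4) unfolding split_by_def by auto
  then show ?thesis
    by (metis insertCI)
next
  case False
  then show ?thesis using assms unfolding split_by_def by blast
qed

lemma steps_trace:
  assumes "(step ^^ n) (W, \<phi>) (W', \<phi>')" "\<Union>\<phi> \<subseteq> W" "K \<in> \<phi>" "x \<in> K"
  shows "\<exists>F\<in>\<phi>'. x \<in> F \<and> F \<inter> W \<subseteq> K"
  using assms
proof (induction n arbitrary: W' \<phi>')
  case (Suc n)
  then obtain W1 \<phi>1 where 1: "(step ^^ n) (W, \<phi>) (W1, \<phi>1)" "step (W1, \<phi>1) (W', \<phi>')"
    by auto
  from 1(2) obtain \<C> \<D> u v where s: "splittable W1 \<phi>1 \<C> \<D> u v"
    and t: "W' = W1 \<union> {u, v}" "\<phi>' = split_by \<phi>1 \<C> \<D> u v" by (auto elim: stepE)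
  obtain F where F: "F \<in> \<phi>1" "x \<in> F" "F \<inter> W \<subseteq> K" using Suc.IH[OF 1(1) Suc.prems(2-4)] by blast
  have sub: "W \<subseteq> W1" "\<Union>\<phi>1 \<subseteq> W1" using steps_subset[OF 1(1) Suc.prems(2)] by auto
  show ?case using step_trace[OF s sub(2) F(1,2)] F(3) sub(1) unfolding t by blast
qed auto

section \<open>Identifying two vertices\<close>

text \<open>Two situations in which merging \<open>v\<close> into \<open>a\<close> loses nothing:
  \<open>a\<close> is absent, and the merge is a renaming, or \<open>a\<close> and \<open>v\<close>
  are twins, and it removes a redundant copy.\<close>

definition inseparable :: "'a \<Rightarrow> 'a \<Rightarrow> 'a set set \<Rightarrow> bool" where
  "inseparable a v \<phi> \<longleftrightarrow> (\<forall>K\<in>\<phi>. a \<notin> K) \<or> (\<forall>K\<in>\<phi>. a \<in> K \<longleftrightarrow> v \<in> K)"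

lemma inj_on_identify:
  assumes "inseparable a v \<phi>"
  shows "inj_on ((`) (id(v := a))) \<phi>"
proof (rule inj_onI)
  fix K L assume KL: "K \<in> \<phi>" "L \<in> \<phi>" "id(v := a) ` K = id(v := a) ` L"
  have im: "x \<in> id(v := a) ` M \<longleftrightarrow> x \<noteq> v \<and> x \<in> M \<or> x = a \<and> v \<in> M" for x M
    by (auto simp: image_iff)
  have eq: "x \<noteq> v \<and> x \<in> K \<or> x = a \<and> v \<in> K \<longleftrightarrow> x \<noteq> v \<and> x \<in> L \<or> x = a \<and> v \<in> L" for x
    using KL(3) im by metis
  show "K = L"
  proof (rule set_eqI)
    fix x
    show "x \<in> K \<longleftrightarrow> x \<in> L"
      using eq[of x] eq[of a] KL(1,2) assms unfolding inseparable_def by metis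
  qed
qed

text \<open>The condition passes backwards: an old clause is either kept or the union of some
  \<open>C\<close> and \<open>D\<close> whose extensions by \<open>u\<close> and \<open>w\<close>
  are in the new family. It makes the merge injective on the old family, so that taking images
  commutes with removing the joins.\<close>

lemma step_identify:
  assumes s: "splittable W \<phi> \<C> \<D> u w" and "a \<in> W" "v \<in> W"
    and sep: "inseparable a v (split_by \<phi> \<C> \<D> u w)"
  defines "m \<equiv> (`) (id(v := a))"
  shows "inseparable a v \<phi> \<and> splittable W (m ` \<phi>) (m ` \<C>) (m ` \<D>) u w \<and>
    m ` split_by \<phi> \<C> \<D> u w = split_by (m ` \<phi>) (m ` \<C>) (m ` \<D>) u w"
proof (intro conjI)
  have uw: "u \<notin> W" "w \<notin> W" "u \<noteq> w" using s unfolding splittable_def by auto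
  then have uw': "u \<noteq> a" "u \<noteq> v" "w \<noteq> a" "w \<noteq> v" using assms(2,3) by auto
  have C: "insert u C \<in> split_by \<phi> \<C> \<D> u w" if "C \<in> \<C>" for C
    using that unfolding split_by_def by blast
  have D: "insert w D \<in> split_by \<phi> \<C> \<D> u w" if "D \<in> \<D>" for D
    using that unfolding split_by_def by blast
  have old: "K \<in> split_by \<phi> \<C> \<D> u w \<or> (\<exists>C\<in>\<C>. \<exists>D\<in>\<D>. K = C \<union> D)" if "K \<in> \<phi>" for K
    using that unfolding split_by_def joins_def by blast
  show sep0: "inseparable a v \<phi>"
    using sep unfolding inseparable_def
  proof (elim disjE)
    assume no: "\<forall>K\<in>split_by \<phi> \<C> \<D> u w. a \<notin> K"
    have "a \<notin> K" if "K \<in> \<phi>" for K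
      using old[OF that] no C D by (metis UnE insertCI)
    then show "(\<forall>K\<in>\<phi>. a \<notin> K) \<or> (\<forall>K\<in>\<phi>. (a \<in> K) = (v \<in> K))" by blast
  next
    assume iff: "\<forall>K\<in>split_by \<phi> \<C> \<D> u w. (a \<in> K) = (v \<in> K)"
    have "(a \<in> C) = (v \<in> C)" if "C \<in> \<C>" for C using iff C[OF that] uw' by (metis insert_iff)
    moreover have "(a \<in> D) = (v \<in> D)" if "D \<in> \<D>" for D using iff D[OF that] uw' by (metis insert_iff)
    ultimately have "(a \<in> K) = (v \<in> K)" if "K \<in> \<phi>" for K
      using old[OF that] iff by blast
    then show "(\<forall>K\<in>\<phi>. a \<notin> K) \<or> (\<forall>K\<in>\<phi>. (a \<in> K) = (v \<in> K))" by blast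
  qed
  have jm: "m ` joins \<C> \<D> = joins (m ` \<C>) (m ` \<D>)"
  proof -
    have Un: "m (C \<union> D) = m C \<union> m D" for C D unfolding m_def by blast
    show ?thesis
    proof (intro equalityI subsetI)
      fix K assume "K \<in> m ` joins \<C> \<D>"
      then obtain C D where "C \<in> \<C>" "D \<in> \<D>" "K = m C \<union> m D" unfolding joins_def using Un by auto
      then show "K \<in> joins (m ` \<C>) (m ` \<D>)" by (simp add: joinsI)
    next
      fix K assume "K \<in> joins (m ` \<C>) (m ` \<D>)"
      then obtain C D where "C \<in> \<C>" "D \<in> \<D>" "K = m (C \<union> D)" unfolding joins_def Un by auto
      then show "K \<in> m ` joins \<C> \<D>" by (simp add: joinsI)
    qed
  qed
  have "joins (m ` \<C>) (m ` \<D>) \<subseteq> m ` \<phi>"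
    unfolding jm[symmetric] using s unfolding splittable_def by (intro image_mono) simp
  moreover have "{} \<notin> m ` \<C>" "{} \<notin> m ` \<D>" using s unfolding splittable_def m_def by (metis image_iff image_is_empty)+
  ultimately show "splittable W (m ` \<phi>) (m ` \<C>) (m ` \<D>) u w"
    using s unfolding splittable_def by simp
  have "m ` (\<phi> - joins \<C> \<D>) = m ` \<phi> - m ` joins \<C> \<D>"
    using inj_on_image_set_diff[OF inj_on_identify[OF sep0], of \<phi> "joins \<C> \<D>"] s
    unfolding m_def splittable_def by auto
  moreover have "m (insert u K) = insert u (m K)" "m (insert w K) = insert w (m K)" for K
    using uw' unfolding m_def by auto
  then have "m ` insert u ` \<C> = insert u ` m ` \<C>" "m ` insert w ` \<D> = insert w ` m ` \<D>"
    by (auto simp: image_image)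
  ultimately show "m ` split_by \<phi> \<C> \<D> u w = split_by (m ` \<phi>) (m ` \<C>) (m ` \<D>) u w"
    unfolding split_by_def jm[symmetric] by (simp add: image_Un)
qed

lemma steps_identify:
  assumes "(step ^^ n) (W, \<phi>) (W', \<phi>')" "a \<in> W" "v \<in> W" "inseparable a v \<phi>'"
  shows "(step ^^ n) (W, (`) (id(v := a)) ` \<phi>) (W', (`) (id(v := a)) ` \<phi>')
    \<and> inseparable a v \<phi>"
  using assms
proof (induction n arbitrary: W \<phi>)
  case (Suc n)
  then obtain W1 \<phi>1 where 1: "step (W, \<phi>) (W1, \<phi>1)" "(step ^^ n) (W1, \<phi>1) (W', \<phi>')"
    using relpowp_Suc_D2[of n step "(W, \<phi>)" "(W', \<phi>')"] by auto
  from 1(1) obtain \<C> \<D> u w where s: "splittable W \<phi> \<C> \<D> u w"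
    and t: "W1 = W \<union> {u, w}" "\<phi>1 = split_by \<phi> \<C> \<D> u w" by (auto elim: stepE)
  have IH: "(step ^^ n) (W1, (`) (id(v := a)) ` \<phi>1) (W', (`) (id(v := a)) ` \<phi>')"
    "inseparable a v \<phi>1"
    using Suc.IH[OF 1(2)] Suc.prems t by auto
  have st: "inseparable a v \<phi>"
    "splittable W ((`) (id(v := a)) ` \<phi>) ((`) (id(v := a)) ` \<C>) ((`) (id(v := a)) ` \<D>) u w"
    "(`) (id(v := a)) ` split_by \<phi> \<C> \<D> u w =
     split_by ((`) (id(v := a)) ` \<phi>) ((`) (id(v := a)) ` \<C>) ((`) (id(v := a)) ` \<D>) u w"
    using step_identify[OF s Suc.prems(2,3) IH(2)[unfolded t]] by auto
  have "step (W, (`) (id(v := a)) ` \<phi>) (W1, (`) (id(v := a)) ` \<phi>1)"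
    unfolding t st(3) by (rule stepI[OF st(2)])
  then show ?case using relpowp_Suc_I2[OF _ IH(1)] st(1) by blast
qed auto

section \<open>Central steps\<close>

text \<open>A step is central at \<open>a\<close> if all of \<open>\<C>\<close> contains \<open>a\<close>. If at most two final clauses
  meet \<open>{a, u, v}\<close>, then there are exactly two of them, one inherited from \<open>\<C>\<close> and one
  from \<open>\<D>\<close>, and this leaves no room for clauses at \<open>a\<close> outside the step.\<close>

lemma central_step_final:
  assumes sub: "\<Union>\<phi> \<subseteq> W" and s: "splittable W \<phi> \<C> \<D> u v" and a: "a \<in> W" "\<forall>C\<in>\<C>. a \<in> C"
    and r: "(step ^^ k) (W \<union> {u, v}, split_by \<phi> \<C> \<D> u v) (W', \<phi>')"
    and fin: "finite \<phi>'" and hits: "card {F \<in> \<phi>'. F \<inter> {a, u, v} \<noteq> {}} \<le> 2"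
  obtains f g where "{F \<in> \<phi>'. F \<inter> {a, u, v} \<noteq> {}} = {f, g}"
    "a \<in> f" "u \<in> f" "v \<notin> f" "v \<in> g" "u \<notin> g" "a \<in> g \<longrightarrow> (\<forall>D\<in>\<D>. a \<in> D)"
    "a \<notin> g \<longrightarrow> (\<forall>D\<in>\<D>. a \<notin> D)" "\<forall>K\<in>\<phi>. a \<in> K \<longrightarrow> K \<in> joins \<C> \<D>"
proof -
  let ?W = "W \<union> {u, v}" and ?\<phi> = "split_by \<phi> \<C> \<D> u v"
  let ?H = "{F \<in> \<phi>'. F \<inter> {a, u, v} \<noteq> {}}"
  have uv: "u \<notin> W" "v \<notin> W" "u \<noteq> v" using s unfolding splittable_def by auto
  then have ne: "u \<noteq> a" "v \<noteq> a" using a(1) by auto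
  note CD = splittable_subset[OF s sub]
  have sub': "\<Union>?\<phi> \<subseteq> ?W" using CD sub unfolding split_by_def by blast
  note trace = steps_trace[OF r sub']
  have mem: "insert u C \<in> ?\<phi>" if "C \<in> \<C>" for C using that unfolding split_by_def by blast
  have mem': "insert v D \<in> ?\<phi>" if "D \<in> \<D>" for D using that unfolding split_by_def by blast
  obtain C0 D0 where 0: "C0 \<in> \<C>" "D0 \<in> \<D>" using s unfolding splittable_def by blast
  obtain f where f: "f \<in> \<phi>'" "u \<in> f" "f \<inter> ?W \<subseteq> insert u C0" using trace[OF mem[OF 0(1)]] by blast
  obtain g where g: "g \<in> \<phi>'" "v \<in> g" "g \<inter> ?W \<subseteq> insert v D0" using trace[OF mem'[OF 0(2)]] by blast
  have vf: "v \<notin> f" using f(3) uv CD(1) 0(1) by blast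
  have ug: "u \<notin> g" using g(3) uv CD(2) 0(2) by blast
  have fg: "f \<noteq> g" using vf g(2) by blast
  have fgH: "{f, g} \<subseteq> ?H" using f g by blast
  have H: "?H = {f, g}"
    using card_seteq[OF _ fgH] hits fg fin by simp
  have H': "F = f \<or> F = g" if "F \<in> \<phi>'" "x \<in> F" "x \<in> {a, u, v}" for F x
    using H that by blast
  have "a \<in> insert u C0" using a(2) 0(1) by blast
  then obtain F where F: "F \<in> \<phi>'" "a \<in> F" "F \<inter> ?W \<subseteq> insert u C0" using trace[OF mem[OF 0(1)]] by blast
  have "v \<notin> F" using F(3) uv CD(1) 0(1) by blast
  then have af: "a \<in> f" using H'[OF F(1,2)] F(2) g(2) by blast
  \<comment> \<open>All traces of \<open>v\<close> end in the one final clause \<open>g\<close>, so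
    its old part is confined by every \<open>D\<close> at once.\<close>
  have gD: "g \<inter> ?W \<subseteq> insert v D" if D: "D \<in> \<D>" for D
  proof -
    obtain F where F: "F \<in> \<phi>'" "v \<in> F" "F \<inter> ?W \<subseteq> insert v D" using trace[OF mem'[OF D]] by blast
    then have "F = g" using H' vf by blast
    then show ?thesis using F by blast
  qed
  have i: "a \<in> g \<longrightarrow> (\<forall>D\<in>\<D>. a \<in> D)"
  proof (intro impI ballI)
    fix D assume "a \<in> g" "D \<in> \<D>"
    then show "a \<in> D" using gD[of D] a(1) ne by blast
  qed
  have "a \<in> g" if aD: "a \<in> D" and D: "D \<in> \<D>" for D
  proof -
    obtain F where F: "F \<in> \<phi>'" "a \<in> F" "F \<inter> ?W \<subseteq> insert v D" using trace[OF mem'[OF D]] aD by blast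
    have "u \<notin> F" using F(3) uv CD(2) D by blast
    then show ?thesis using H'[OF F(1,2)] F(2) f(2) by blast
  qed
  then have ii: "a \<notin> g \<longrightarrow> (\<forall>D\<in>\<D>. a \<notin> D)" by blast
  \<comment> \<open>A clause at \<open>a\<close> left alone by the step would have a trace with
    \<open>a\<close> but neither \<open>u\<close> nor \<open>v\<close>, a third hit.\<close>
  have "K \<in> joins \<C> \<D>" if K: "K \<in> \<phi>" "a \<in> K" for K
  proof (rule ccontr)
    assume "K \<notin> joins \<C> \<D>"
    then have "K \<in> ?\<phi>" using K unfolding split_by_def by blast
    then obtain F where F: "F \<in> \<phi>'" "a \<in> F" "F \<inter> ?W \<subseteq> K" using trace K(2) by blast
    have "u \<notin> F" "v \<notin> F" using F(3) K(1) sub uv by blast+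
    then show False using H'[OF F(1,2)] f(2) g(2) by blast
  qed
  then have iii: "\<forall>K\<in>\<phi>. a \<in> K \<longrightarrow> K \<in> joins \<C> \<D>" by blast
  show ?thesis by (rule that[OF H af f(2) vf g(2) ug i ii iii])
qed

text \<open>Such a step with \<open>\<C> = {{a}}\<close> can be left out: deleting \<open>u\<close> removes the clause
  \<open>{a, u}\<close>, after which \<open>v\<close> plays the role that \<open>a\<close> had before the step.\<close>

lemma drop_central_step:
  assumes sub: "\<Union>\<phi> \<subseteq> W" and s: "splittable W \<phi> {{a}} \<D> u v" and a: "a \<in> W"
    and r: "(step ^^ k) (W \<union> {u, v}, split_by \<phi> {{a}} \<D> u v) (W', \<phi>')"
    and fin: "finite \<phi>'" and hits: "card {F \<in> \<phi>'. F \<inter> {a, u, v} \<noteq> {}} \<le> 2"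
  shows "\<exists>m\<le>k. \<exists>V' \<psi>. (step ^^ m) (W, \<phi>) (V', \<psi>) \<and> finite \<psi> \<and> card \<psi> \<le> card \<phi>'"
proof -
  have c: "\<forall>C\<in>{{a}}. a \<in> C" by simp
  obtain f g where fg: "{F \<in> \<phi>'. F \<inter> {a, u, v} \<noteq> {}} = {f, g}"
    "a \<in> f" "u \<in> f" "v \<notin> f" "v \<in> g" "u \<notin> g" "a \<in> g \<longrightarrow> (\<forall>D\<in>\<D>. a \<in> D)"
    "a \<notin> g \<longrightarrow> (\<forall>D\<in>\<D>. a \<notin> D)" "\<forall>K\<in>\<phi>. a \<in> K \<longrightarrow> K \<in> joins {{a}} \<D>"
    by (rule central_step_final[OF sub s a c r fin hits])
  let ?W = "W \<union> {u, v}" and ?\<phi> = "split_by \<phi> {{a}} \<D> u v"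
  have uv: "u \<notin> W" "v \<notin> W" "u \<noteq> v" using s unfolding splittable_def by auto
  note CD = splittable_subset[OF s sub]
  have sub': "\<Union>?\<phi> \<subseteq> ?W" using CD sub unfolding split_by_def by blast
  obtain m L' V' where 1: "m \<le> k" "{u} \<subseteq> L'" "(step ^^ m) (?W, avoid {u} ?\<phi>) (V', avoid L' \<phi>')"
    using steps_avoid[OF r sub', of "{u}" ?W] by blast
  have av: "avoid {u} ?\<phi> = (\<phi> - joins {{a}} \<D>) \<union> insert v ` \<D>"
  proof -
    have "u \<notin> K" if "K \<in> \<phi>" for K using that sub uv by blast
    moreover have "u \<notin> insert v D" if "D \<in> \<D>" for D using that CD(2) uv by blast
    ultimately show ?thesis unfolding avoid_def split_by_def by auto
  qed
  have fin': "F = g" if "F \<in> avoid L' \<phi>'" "F \<inter> {a, v} \<noteq> {}" for F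
  proof -
    have "F \<in> {f, g}" "u \<notin> F" unfolding fg(1)[symmetric] using that 1(2) unfolding avoid_def by auto
    then show ?thesis using fg(3) by blast
  qed
  \<comment> \<open>Deleting \<open>u\<close> loses \<open>f\<close>. Only \<open>g\<close> can
    still meet \<open>{a, v}\<close>, and it contains \<open>v\<close>, so either \<open>a\<close>
    is absent or \<open>a\<close> and \<open>v\<close> both occur exactly in
    \<open>g\<close>.\<close>
  have sep: "inseparable a v (avoid L' \<phi>')"
    unfolding inseparable_def using fin' fg(5) by blast
  have im: "(`) (id(v := a)) ` avoid {u} ?\<phi> = \<phi>"
  proof -
    have id: "id(v := a) ` K = K" if "v \<notin> K" for K using that by (auto simp: image_iff)
    have 1: "id(v := a) ` K = K" if "K \<in> \<phi>" for K using id that sub uv by blast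
    have 2: "id(v := a) ` insert v D = {a} \<union> D" if "D \<in> \<D>" for D
      using id[of D] that CD(2) uv by auto
    have "(`) (id(v := a)) ` (\<phi> - joins {{a}} \<D>) = \<phi> - joins {{a}} \<D>"
      using 1 by (force simp: image_iff)
    moreover have "(`) (id(v := a)) ` insert v ` \<D> = joins {{a}} \<D>"
      using 2 unfolding joins_def by (force simp: image_iff)
    ultimately have "(`) (id(v := a)) ` avoid {u} ?\<phi> = (\<phi> - joins {{a}} \<D>) \<union> joins {{a}} \<D>"
      unfolding av image_Un by simp
    then show ?thesis using s unfolding splittable_def by blast
  qed
  have "(step ^^ m) (?W, \<phi>) (V', (`) (id(v := a)) ` avoid L' \<phi>')"
    using steps_identify[OF 1(3) _ _ sep] a unfolding im by auto
  then obtain V'' where "(step ^^ m) (W, \<phi>) (V'', (`) (id(v := a)) ` avoid L' \<phi>')"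
    using steps_weaken[of m ?W \<phi> V' _ W] by blast
  moreover have "finite (avoid L' \<phi>')" using fin avoid_subset by (metis finite_subset)
  moreover have "card ((`) (id(v := a)) ` avoid L' \<phi>') \<le> card \<phi>'"
    using card_image_le[OF calculation(2)] card_mono[OF fin avoid_subset] by (metis le_trans)
  ultimately show ?thesis using 1(1) by blast
qed

section \<open>An undecided clause\<close>

text \<open>The step with \<open>\<C> = {{a}, {b}}\<close> and \<open>{a, b} \<in> \<D>\<close> replaces the clause \<open>{a, b}\<close> by a
  proper superset. As long as no step is central at \<open>a\<close> or \<open>b\<close>, the clauses containing both
  \<open>a\<close> and \<open>b\<close> can be replaced by a single clause \<open>{a, b}\<close> that takes no part in the
  derivation.\<close>

definition undecided :: "'a \<Rightarrow> 'a \<Rightarrow> 'a set set \<Rightarrow> bool" where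
  "undecided a b \<phi> \<longleftrightarrow> {a} \<notin> \<phi> \<and> {b} \<notin> \<phi> \<and> {a, b} \<notin> \<phi> \<and>
     (\<exists>K\<in>\<phi>. a \<in> K \<and> b \<in> K) \<and> (\<exists>K\<in>\<phi>. a \<in> K \<and> b \<notin> K) \<and> (\<exists>K\<in>\<phi>. b \<in> K \<and> a \<notin> K) \<and>
     (\<forall>K\<in>\<phi>. \<forall>K'\<in>\<phi>. \<forall>x. a \<in> K \<and> b \<in> K \<and> x \<in> K \<and> x \<noteq> a \<and> x \<noteq> b \<and> x \<in> K' \<longrightarrow>
        (a \<in> K' \<longleftrightarrow> b \<in> K'))"

definition decide :: "'a \<Rightarrow> 'a \<Rightarrow> 'a set set \<Rightarrow> 'a set set" where
  "decide a b \<phi> = insert {a, b} {K \<in> \<phi>. \<not> (a \<in> K \<and> b \<in> K)}"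

lemma undecided_commute: "undecided a b \<phi> \<longleftrightarrow> undecided b a \<phi>"
  unfolding undecided_def insert_commute[of a b] by auto

text \<open>The part of the invariant that does the work: a vertex sharing a clause with both
  \<open>a\<close> and \<open>b\<close> never meets exactly one of them. The arguments below refute
  a configuration by exhibiting such a meeting.\<close>

lemma undecidedD:
  assumes "undecided a b \<phi>" "K \<in> \<phi>" "K' \<in> \<phi>" "a \<in> K" "b \<in> K" "x \<in> K" "x \<in> K'" "x \<noteq> a" "x \<noteq> b"
  shows "a \<in> K' \<longleftrightarrow> b \<in> K'"
  using assms unfolding undecided_def by blast

lemma card_decide_le:
  assumes "undecided a b \<phi>" "finite \<phi>"
  shows "finite (decide a b \<phi>)" "card (decide a b \<phi>) \<le> card \<phi>"
proof -
  obtain K where K: "K \<in> \<phi>" "a \<in> K" "b \<in> K" using assms(1) unfolding undecided_def by blast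
  let ?R = "{K \<in> \<phi>. \<not> (a \<in> K \<and> b \<in> K)}"
  have "insert K ?R \<subseteq> \<phi>" using K by blast
  then have "card (insert K ?R) \<le> card \<phi>" using card_mono[OF assms(2)] by blast
  moreover have "card (insert K ?R) = Suc (card ?R)" using K assms(2) by simp
  ultimately show "card (decide a b \<phi>) \<le> card \<phi>" unfolding decide_def
    using card_insert_le_m1 assms(2) by (simp add: card_insert_if)
  show "finite (decide a b \<phi>)" using assms(2) unfolding decide_def by simp
qed

text \<open>If \<open>a\<close> came only from \<open>C\<close> and \<open>b\<close> only from
  \<open>D\<close>, their join would contain a third vertex \<open>x\<close>, as
  \<open>{a, b}\<close> is no clause. Exchanging the side without \<open>x\<close> for one lacking
  its endpoint gives a clause with \<open>x\<close> and exactly one of \<open>a\<close> and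
  \<open>b\<close>.\<close>

lemma undecided_no_crossing:
  assumes U: "undecided a b \<phi>" and s: "splittable W \<phi> \<C> \<D> u v"
    and nc: "\<exists>C\<in>\<C>. a \<notin> C" "\<exists>D\<in>\<D>. b \<notin> D"
    and CD: "C \<in> \<C>" "D \<in> \<D>" "a \<in> C" "b \<notin> C" "a \<notin> D"
  shows "b \<notin> D"
proof
  assume b: "b \<in> D"
  obtain C2 where C2: "C2 \<in> \<C>" "a \<notin> C2" using nc(1) by blast
  obtain D2 where D2: "D2 \<in> \<D>" "b \<notin> D2" using nc(2) by blast
  note mem = splittable_Un[OF s]
  have "C \<union> D \<noteq> {a, b}" using U mem[OF CD(1,2)] unfolding undecided_def by metis
  then obtain x where x: "x \<in> C \<union> D" "x \<noteq> a" "x \<noteq> b" using CD b by blast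
  show False
  proof (cases "x \<in> C")
    case True
    then show ?thesis
      using undecidedD[OF U mem[OF CD(1,2)] mem[OF CD(1) D2(1)], of x] CD b D2(2) x by blast
  next
    case False
    then show ?thesis
      using undecidedD[OF U mem[OF CD(1,2)] mem[OF C2(1) CD(2)], of x] CD b C2(2) x by blast
  qed
qed

text \<open>Needed for the invariant at the fresh vertex, which marks all of \<open>\<C>\<close>. A
  side \<open>D\<close> without \<open>a\<close> and \<open>b\<close> is nonempty, and any of its
  vertices lies in both \<open>C \<union> D\<close> and \<open>C' \<union> D\<close>.\<close>

lemma undecided_new_vertex:
  assumes U: "undecided a b \<phi>" and s: "splittable W \<phi> \<C> \<D> u v"
    and nc: "\<exists>D\<in>\<D>. a \<notin> D"
    and cross: "\<And>C D. C \<in> \<C> \<Longrightarrow> D \<in> \<D> \<Longrightarrow> a \<in> C \<Longrightarrow> b \<notin> C \<Longrightarrow> a \<notin> D \<Longrightarrow> b \<notin> D"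
    and C: "C \<in> \<C>" "a \<in> C" "b \<in> C" and C': "C' \<in> \<C>" "a \<in> C'"
  shows "b \<in> C'"
proof (rule ccontr)
  assume b: "b \<notin> C'"
  obtain D where D: "D \<in> \<D>" "a \<notin> D" using nc by blast
  have bD: "b \<notin> D" using cross[OF C'(1) D(1) C'(2) b D(2)] .
  have "D \<noteq> {}" using s D(1) unfolding splittable_def by blast
  then obtain y where y: "y \<in> D" by blast
  show False
    using undecidedD[OF U splittable_Un[OF s C(1) D(1)] splittable_Un[OF s C'(1) D(1)], of y]
      C C' b D(2) bD y by blast
qed

lemma undecided_step:
  assumes U: "undecided a b \<phi>" and s: "splittable W \<phi> \<C> \<D> u v"
    and ab: "a \<in> W" "b \<in> W" and sub: "\<Union>\<phi> \<subseteq> W"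
    and nc: "\<exists>C\<in>\<C>. a \<notin> C" "\<exists>C\<in>\<C>. b \<notin> C" "\<exists>D\<in>\<D>. a \<notin> D" "\<exists>D\<in>\<D>. b \<notin> D"
  shows "undecided a b (split_by \<phi> \<C> \<D> u v)"
    and "step (W, decide a b \<phi>) (W \<union> {u, v}, decide a b (split_by \<phi> \<C> \<D> u v))"
proof -
  have U': "undecided b a \<phi>" using U undecided_commute by metis
  have s': "splittable W \<phi> \<D> \<C> v u" using s splittable_commute by metis
  have uv: "u \<notin> W" "v \<notin> W" "u \<noteq> v" using s unfolding splittable_def by auto
  then have ne: "u \<noteq> a" "u \<noteq> b" "v \<noteq> a" "v \<noteq> b" using ab by auto
  note cross1 = undecided_no_crossing[OF U s nc(1,4)]
  note cross2 = undecided_no_crossing[OF U' s nc(2,3)]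
  note cross3 = undecided_no_crossing[OF U s' nc(3,2)]
  note cross4 = undecided_no_crossing[OF U' s' nc(4,1)]
  have cross: "a \<in> C \<and> b \<in> C \<or> a \<in> D \<and> b \<in> D"
    if "C \<in> \<C>" "D \<in> \<D>" "a \<in> C \<union> D" "b \<in> C \<union> D" for C D
    using cross1[of C D] cross2[of C D] that by blast
  note newC1 = undecided_new_vertex[OF U s nc(3) cross1]
  note newC2 = undecided_new_vertex[OF U' s nc(4) cross2]
  note newD1 = undecided_new_vertex[OF U s' nc(1) cross3]
  note newD2 = undecided_new_vertex[OF U' s' nc(2) cross4]
  note mem = splittable_Un[OF s]
  note subCD = splittable_subset[OF s sub]
  let ?\<phi> = "split_by \<phi> \<C> \<D> u v"
  have in_split: "K \<in> ?\<phi> \<longleftrightarrow> K \<in> \<phi> \<and> K \<notin> joins \<C> \<D> \<or> (\<exists>C\<in>\<C>. K = insert u C) \<or> (\<exists>D\<in>\<D>. K = insert v D)"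
    for K unfolding split_by_def by blast
  \<comment> \<open>\<open>K\<close> is matched with an old clause that contains both
    \<open>a\<close> and \<open>b\<close> only if \<open>K\<close> does. Unless \<open>C\<close>
    itself contains both, its partner \<open>D\<close> is chosen without \<open>a\<close>, and
    \<open>cross\<close> keeps the join from containing both.\<close>
  have lift: "\<exists>K0\<in>\<phi>. K \<inter> W \<subseteq> K0 \<and> (a \<in> K0 \<and> b \<in> K0 \<longrightarrow> a \<in> K \<and> b \<in> K)" if "K \<in> ?\<phi>" for K
    using that unfolding in_split
  proof (elim disjE bexE)
    fix C assume C: "C \<in> \<C>" "K = insert u C"
    show ?thesis
    proof (cases "a \<in> C \<and> b \<in> C")
      case True
      obtain D where "D \<in> \<D>" using nc by blast
      then show ?thesis using C True mem[of C D] uv by blast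
    next
      case False
      obtain D where D: "D \<in> \<D>" "a \<notin> D" using nc by blast
      have "\<not> (a \<in> C \<union> D \<and> b \<in> C \<union> D)" using cross[OF C(1) D(1)] False D(2) by blast
      moreover have "K \<inter> W \<subseteq> C \<union> D" using C uv by blast
      ultimately show ?thesis using mem[OF C(1) D(1)] by blast
    qed
  next
    fix D assume D: "D \<in> \<D>" "K = insert v D"
    show ?thesis
    proof (cases "a \<in> D \<and> b \<in> D")
      case True
      obtain C where "C \<in> \<C>" using nc by blast
      then show ?thesis using D True mem[of C D] uv by blast
    next
      case False
      obtain C where C: "C \<in> \<C>" "a \<notin> C" using nc by blast
      have "\<not> (a \<in> C \<union> D \<and> b \<in> C \<union> D)" using cross[OF C(1) D(1)] False C(2) by blast
      moreover have "K \<inter> W \<subseteq> C \<union> D" using D uv by blast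
      ultimately show ?thesis using mem[OF C(1) D(1)] by blast
    qed
  qed auto
  have J: "a \<in> K' \<longleftrightarrow> b \<in> K'"
    if K: "K \<in> ?\<phi>" "K' \<in> ?\<phi>" "a \<in> K" "b \<in> K" "x \<in> K" "x \<noteq> a" "x \<noteq> b" "x \<in> K'" for K K' x
  proof (cases "x \<in> W")
    case True
    obtain K0 where K0: "K0 \<in> \<phi>" "K \<inter> W \<subseteq> K0" using lift[OF K(1)] by blast
    obtain K1 where K1: "K1 \<in> \<phi>" "K' \<inter> W \<subseteq> K1" "a \<in> K1 \<and> b \<in> K1 \<longrightarrow> a \<in> K' \<and> b \<in> K'"
      using lift[OF K(2)] by blast
    have "a \<in> K1 \<longleftrightarrow> b \<in> K1"
      by (rule undecidedD[OF U K0(1) K1(1), of x]) (use K K0 K1 ab True in auto)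
    then show ?thesis using K1 ab by blast
  next
    case False
    then have xuv: "x = u \<or> x = v"
    proof -
      have "\<Union>?\<phi> \<subseteq> W \<union> {u, v}" using sub subCD unfolding split_by_def by blast
      then show ?thesis using K(1,5) False by blast
    qed
    have old: "x \<notin> K0" if "K0 \<in> \<phi> \<or> K0 \<in> \<C> \<or> K0 \<in> \<D>" for K0 using False that sub subCD by blast
    from xuv show ?thesis
    proof
      assume x: "x = u"
      obtain C where C: "C \<in> \<C>" "K = insert u C" using K(1,5) old x uv(3) unfolding in_split by blast
      obtain C' where C': "C' \<in> \<C>" "K' = insert u C'" using K(2,8) old x uv(3) unfolding in_split by blast
      have "a \<in> C" "b \<in> C" using K(3,4) C ne by auto
      then have "a \<in> C' \<Longrightarrow> b \<in> C'" "b \<in> C' \<Longrightarrow> a \<in> C'"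
        using newC1[OF _ _ _ _ _ C(1) _ _ C'(1)] newC2[OF _ _ _ _ _ C(1) _ _ C'(1)] by simp_all
      then show ?thesis using C' ne by auto
    next
      assume x: "x = v"
      obtain D where D: "D \<in> \<D>" "K = insert v D" using K(1,5) old x uv(3) unfolding in_split by blast
      obtain D' where D': "D' \<in> \<D>" "K' = insert v D'" using K(2,8) old x uv(3) unfolding in_split by blast
      have "a \<in> D" "b \<in> D" using K(3,4) D ne by auto
      then have "a \<in> D' \<Longrightarrow> b \<in> D'" "b \<in> D' \<Longrightarrow> a \<in> D'"
        using newD1[OF _ _ _ _ _ D(1) _ _ D'(1)] newD2[OF _ _ _ _ _ D(1) _ _ D'(1)] by simp_all
      then show ?thesis using D' ne by auto
    qed
  qed
  have small: "K \<notin> ?\<phi>" if "K \<subseteq> {a, b}" "K \<notin> \<phi>" for K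
    using that ne unfolding in_split by auto
  have keep: "\<exists>K\<in>?\<phi>. x \<in> K \<and> (y \<in> K \<longrightarrow> y \<in> K0)" if "K0 \<in> \<phi>" "x \<in> K0" "y \<in> W" for K0 x y
    using step_trace[OF s sub that(1,2)] that(3) by blast
  show U1: "undecided a b ?\<phi>"
    unfolding undecided_def
  proof (intro conjI)
    show "{a} \<notin> ?\<phi>" "{b} \<notin> ?\<phi>" "{a, b} \<notin> ?\<phi>" using small U unfolding undecided_def by auto
    show "\<exists>K\<in>?\<phi>. a \<in> K \<and> b \<notin> K" "\<exists>K\<in>?\<phi>. b \<in> K \<and> a \<notin> K"
      using keep ab U unfolding undecided_def by metis+
    show "\<exists>K\<in>?\<phi>. a \<in> K \<and> b \<in> K"
    proof -
      obtain K where K: "K \<in> \<phi>" "a \<in> K" "b \<in> K" using U unfolding undecided_def by blast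
      show ?thesis
      proof (cases "K \<in> joins \<C> \<D>")
        case True
        then obtain C D where CD: "C \<in> \<C>" "D \<in> \<D>" "K = C \<union> D" unfolding joins_def by blast
        have "insert u C \<in> ?\<phi>" "insert v D \<in> ?\<phi>" using CD in_split by blast+
        then show ?thesis using cross[OF CD(1,2)] K CD(3) by (metis insertCI)
      next
        case False
        then show ?thesis using K in_split by blast
      qed
    qed
    show "\<forall>K\<in>?\<phi>. \<forall>K'\<in>?\<phi>. \<forall>x. a \<in> K \<and> b \<in> K \<and> x \<in> K \<and> x \<noteq> a \<and> x \<noteq> b \<and> x \<in> K' \<longrightarrow>
        (a \<in> K' \<longleftrightarrow> b \<in> K')"
      using J by blast
  qed
  \<comment> \<open>By \<open>cross\<close> a join contains both vertices only if one of its sides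
    does, so discarding those sides discards exactly those joins.\<close>
  define \<C>' \<D>' where "\<C>' = {C \<in> \<C>. \<not> (a \<in> C \<and> b \<in> C)}" and "\<D>' = {D \<in> \<D>. \<not> (a \<in> D \<and> b \<in> D)}"
  have jn: "joins \<C>' \<D>' = {K \<in> joins \<C> \<D>. \<not> (a \<in> K \<and> b \<in> K)}"
  proof (intro equalityI subsetI)
    fix K assume "K \<in> joins \<C>' \<D>'"
    then obtain C D where "C \<in> \<C>'" "D \<in> \<D>'" "K = C \<union> D" unfolding joins_def by blast
    then show "K \<in> {K \<in> joins \<C> \<D>. \<not> (a \<in> K \<and> b \<in> K)}"
      using cross[of C D] joinsI[of C \<C> D \<D>] unfolding \<C>'_def \<D>'_def by blast
  next
    fix K assume "K \<in> {K \<in> joins \<C> \<D>. \<not> (a \<in> K \<and> b \<in> K)}"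
    then obtain C D where "C \<in> \<C>" "D \<in> \<D>" "K = C \<union> D" "\<not> (a \<in> K \<and> b \<in> K)"
      unfolding joins_def by blast
    then show "K \<in> joins \<C>' \<D>'" using joinsI[of C \<C>' D \<D>'] unfolding \<C>'_def \<D>'_def by blast
  qed
  have "splittable W (decide a b \<phi>) \<C>' \<D>' u v"
  proof -
    have "\<C>' \<noteq> {}" "\<D>' \<noteq> {}" using nc unfolding \<C>'_def \<D>'_def by blast+
    moreover have "{} \<notin> \<C>'" "{} \<notin> \<D>'" using s unfolding \<C>'_def \<D>'_def splittable_def by blast+
    moreover have "joins \<C>' \<D>' \<subseteq> decide a b \<phi>"
      unfolding jn decide_def using s unfolding splittable_def by blast
    ultimately show ?thesis using uv unfolding splittable_def by blast
  qed
  moreover have "decide a b ?\<phi> = split_by (decide a b \<phi>) \<C>' \<D>' u v"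
  proof -
    have "{K \<in> insert u ` \<C>. \<not> (a \<in> K \<and> b \<in> K)} = insert u ` \<C>'"
      using ne unfolding \<C>'_def by blast
    moreover have "{K \<in> insert v ` \<D>. \<not> (a \<in> K \<and> b \<in> K)} = insert v ` \<D>'"
      using ne unfolding \<D>'_def by blast
    moreover have "{K \<in> ?\<phi>. \<not> (a \<in> K \<and> b \<in> K)} = {K \<in> \<phi> - joins \<C> \<D>. \<not> (a \<in> K \<and> b \<in> K)} \<union>
        {K \<in> insert u ` \<C>. \<not> (a \<in> K \<and> b \<in> K)} \<union> {K \<in> insert v ` \<D>. \<not> (a \<in> K \<and> b \<in> K)}"
      unfolding split_by_def by blast
    moreover have "{K \<in> \<phi> - joins \<C> \<D>. \<not> (a \<in> K \<and> b \<in> K)} = {K \<in> \<phi>. \<not> (a \<in> K \<and> b \<in> K)} - joins \<C>' \<D>'"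
      unfolding jn by blast
    moreover have "{a, b} \<notin> joins \<C>' \<D>'" unfolding jn by blast
    ultimately show ?thesis unfolding decide_def split_by_def[of "insert _ _"] by (simp add: insert_Diff_if)
  qed
  ultimately show "step (W, decide a b \<phi>) (W \<union> {u, v}, decide a b ?\<phi>)"
    using stepI by metis
qed

text \<open>All of \<open>\<C>\<close> contains \<open>a\<close>, so by the invariant a join with
  \<open>b\<close> and a join without \<open>b\<close> share nothing but \<open>a\<close>. Two such
  joins with a common side force this side to be \<open>{a}\<close>; if both sides of a join were
  \<open>{a}\<close>, then \<open>{a}\<close> would be a clause.\<close>

lemma undecided_central_step:
  assumes U: "undecided a b \<phi>" and s: "splittable W \<phi> \<C> \<D> u v"
    and a: "\<forall>C\<in>\<C>. a \<in> C" and unif: "(\<forall>D\<in>\<D>. a \<in> D) \<or> (\<forall>D\<in>\<D>. a \<notin> D)"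
    and all: "\<forall>K\<in>\<phi>. a \<in> K \<longrightarrow> K \<in> joins \<C> \<D>"
  shows "\<C> = {{a}} \<or> \<D> = {{a}}"
proof -
  note mem = splittable_Un[OF s]
  obtain K where "K \<in> \<phi>" "a \<in> K" "b \<in> K" using U unfolding undecided_def by blast
  then obtain C1 D1 where 1: "C1 \<in> \<C>" "D1 \<in> \<D>" "b \<in> C1 \<union> D1" using all unfolding joins_def by blast
  obtain K' where "K' \<in> \<phi>" "a \<in> K'" "b \<notin> K'" using U unfolding undecided_def by blast
  then obtain C2 D2 where 2: "C2 \<in> \<C>" "D2 \<in> \<D>" "b \<notin> C2" "b \<notin> D2" using all unfolding joins_def by blast
  have noC: "{} \<notin> \<C>" and noD: "{} \<notin> \<D>" using s unfolding splittable_def by auto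
  have unit: "{a} \<notin> \<phi>" using U unfolding undecided_def by blast
  have sh: "x = a" if "C \<in> \<C>" "D \<in> \<D>" "C' \<in> \<C>" "D' \<in> \<D>" "b \<in> C \<union> D" "b \<notin> C' \<union> D'"
    "x \<in> C \<union> D" "x \<in> C' \<union> D'" for C D C' D' x
    using undecidedD[OF U mem[OF that(1,2)] mem[OF that(3,4)], of x] that a by blast
  show ?thesis
  proof (cases "b \<in> C1")
    case False
    have C1: "C1 = {a}" using sh[OF 1(1,2) 1(1) 2(2) 1(3)] False 2(4) 1(1) a by blast
    have bD1: "b \<in> D1" using 1(3) False by blast
    have "C = {a}" if C: "C \<in> \<C>" for C
    proof (cases "b \<in> C")
      case True
      have "D2 \<subseteq> {a}" using sh[OF C 2(2) 1(1) 2(2)] True False 2(4) by blast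
      then have "C1 \<union> D2 = {a}" using C1 by blast
      then show ?thesis using mem[OF 1(1) 2(2)] unit by simp
    next
      case no: False
      show ?thesis using sh[OF C 1(2) C 2(2)] bD1 no 2(4) C a by blast
    qed
    then have "\<C> = {{a}}" using 1(1) by blast
    then show ?thesis by blast
  next
    case True
    have "D2 \<subseteq> {a}" using sh[OF 1(1) 2(2) 2(1,2)] True 2 by blast
    then have D2: "D2 = {a}" using noD 2(2) subset_singletonD by metis
    then have aD: "\<forall>D\<in>\<D>. a \<in> D" using unif 2(2) by blast
    have "D = {a}" if D: "D \<in> \<D>" for D
    proof (cases "b \<in> D")
      case bD: True
      have "C2 \<subseteq> {a}" using sh[OF 2(1) D 2(1,2)] bD 2 by blast
      then have "C2 \<union> D2 = {a}" using D2 by blast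
      then show ?thesis using mem[OF 2(1,2)] unit by simp
    next
      case False
      show ?thesis using sh[OF 1(1) D 2(1) D] True False 2 D aD by blast
    qed
    then have "\<D> = {{a}}" using 2(2) by blast
    then show ?thesis by blast
  qed
qed

definition central :: "'a \<Rightarrow> 'a set set \<Rightarrow> 'a set set \<Rightarrow> bool" where
  "central a \<C> \<D> \<longleftrightarrow> (\<forall>C\<in>\<C>. a \<in> C) \<or> (\<forall>D\<in>\<D>. a \<in> D)"

text \<open>The induction runs from the front, so the second alternative stops at the first step
  central at \<open>a\<close> or \<open>b\<close>, where the invariant still holds.\<close>

lemma undecided_steps:
  assumes "(step ^^ n) (W, \<phi>) (W', \<phi>')" "undecided a b \<phi>" "a \<in> W" "b \<in> W" "\<Union>\<phi> \<subseteq> W"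
  shows "(undecided a b \<phi>' \<and> (step ^^ n) (W, decide a b \<phi>) (W', decide a b \<phi>')) \<or>
    (\<exists>i j W1 \<phi>1 \<C> \<D> u v. n = i + Suc j \<and> (step ^^ i) (W, \<phi>) (W1, \<phi>1) \<and> undecided a b \<phi>1 \<and>
      splittable W1 \<phi>1 \<C> \<D> u v \<and> (central a \<C> \<D> \<or> central b \<C> \<D>) \<and>
      (step ^^ j) (W1 \<union> {u, v}, split_by \<phi>1 \<C> \<D> u v) (W', \<phi>'))"
  using assms
proof (induction n arbitrary: W \<phi>)
  case (Suc n)
  then obtain t where 1: "step (W, \<phi>) t" "(step ^^ n) t (W', \<phi>')"
    using relpowp_Suc_D2[of n step "(W, \<phi>)" "(W', \<phi>')"] by auto
  from 1(1) obtain \<C> \<D> u v where s: "splittable W \<phi> \<C> \<D> u v"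
    and t: "t = (W \<union> {u, v}, split_by \<phi> \<C> \<D> u v)" by (auto elim: stepE)
  show ?case
  proof (cases "central a \<C> \<D> \<or> central b \<C> \<D>")
    case True
    have "Suc n = 0 + Suc n" "(step ^^ 0) (W, \<phi>) (W, \<phi>)" by auto
    then show ?thesis using True s 1(2)[unfolded t] Suc.prems(2) by blast
  next
    case False
    let ?\<phi> = "split_by \<phi> \<C> \<D> u v"
    have nc: "\<exists>C\<in>\<C>. a \<notin> C" "\<exists>C\<in>\<C>. b \<notin> C" "\<exists>D\<in>\<D>. a \<notin> D" "\<exists>D\<in>\<D>. b \<notin> D"
      using False unfolding central_def by auto
    note st = undecided_step[OF Suc.prems(2) s Suc.prems(3-5) nc]
    have sub: "\<Union>?\<phi> \<subseteq> W \<union> {u, v}"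
      using splittable_subset[OF s Suc.prems(5)] Suc.prems(5) unfolding split_by_def by blast
    have ab: "a \<in> W \<union> {u, v}" "b \<in> W \<union> {u, v}" using Suc.prems(3,4) by auto
    from Suc.IH[OF 1(2)[unfolded t] st(1) ab sub] show ?thesis
    proof (elim disjE)
      assume "undecided a b \<phi>' \<and> (step ^^ n) (W \<union> {u, v}, decide a b ?\<phi>) (W', decide a b \<phi>')"
      then have "undecided a b \<phi>'" "(step ^^ Suc n) (W, decide a b \<phi>) (W', decide a b \<phi>')"
        using relpowp_Suc_I2[of step, OF st(2)] by auto
      then show ?thesis by blast
    next
      assume "\<exists>i j W1 \<phi>1 \<C> \<D> u' v'. n = i + Suc j \<and> (step ^^ i) (W \<union> {u, v}, ?\<phi>) (W1, \<phi>1) \<and>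
        undecided a b \<phi>1 \<and> splittable W1 \<phi>1 \<C> \<D> u' v' \<and> (central a \<C> \<D> \<or> central b \<C> \<D>) \<and>
        (step ^^ j) (W1 \<union> {u', v'}, split_by \<phi>1 \<C> \<D> u' v') (W', \<phi>')"
      then obtain i j W1 \<phi>1 \<C>' \<D>' u' v' where *: "n = i + Suc j"
        "(step ^^ i) (W \<union> {u, v}, ?\<phi>) (W1, \<phi>1)" "undecided a b \<phi>1" "splittable W1 \<phi>1 \<C>' \<D>' u' v'"
        "central a \<C>' \<D>' \<or> central b \<C>' \<D>'"
        "(step ^^ j) (W1 \<union> {u', v'}, split_by \<phi>1 \<C>' \<D>' u' v') (W', \<phi>')" by blast
      have "Suc n = Suc i + Suc j" using *(1) by simp
      moreover have "(step ^^ Suc i) (W, \<phi>) (W1, \<phi>1)" by (rule relpowp_Suc_I2[OF stepI[OF s] *(2)])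
      ultimately show ?thesis using *(3-6) by blast
    qed
  qed
qed auto

section \<open>The quadratic form\<close>

definition qform :: "'a set set \<Rightarrow> 'a set set \<Rightarrow> ('a \<Rightarrow> real) \<Rightarrow> real" where
  "qform E P f = (\<Sum>e\<in>E. \<Prod>x\<in>e. f x) - (\<Sum>p\<in>P. \<Prod>x\<in>p. f x)"

text \<open>\<open>neg_dim E P d\<close>: some \<open>d\<close>-dimensional space of functions makes \<open>qform E P\<close> negative
  definite; the functions \<open>F i\<close>, \<open>i \<in> J\<close>, are a basis of it.\<close>

definition neg_dim :: "'a set set \<Rightarrow> 'a set set \<Rightarrow> nat \<Rightarrow> bool" where
  "neg_dim E P d \<longleftrightarrow> (\<exists>(J :: nat set) F. finite J \<and> card J = d \<and>
     (\<forall>c. (\<exists>i\<in>J. c i \<noteq> 0) \<longrightarrow> qform E P (\<lambda>x. \<Sum>i\<in>J. c i * F i x) < 0))"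

lemma prod_doubleton: "x \<noteq> y \<Longrightarrow> (\<Prod>z\<in>{x, y}. f z) = f x * (f y :: real)"
  by simp

lemma neg_dim_0: "neg_dim E P 0"
  unfolding neg_dim_def by (rule exI[of _ "{}"]) auto

lemma qform_avoid:
  assumes "finite E" "finite P" "\<forall>e\<in>E \<union> P. finite e" "f a = 0"
  shows "qform (avoid {a} E) (avoid {a} P) f = qform E P f"
proof -
  have "(\<Sum>e\<in>avoid {a} \<A>. \<Prod>x\<in>e. f x) = (\<Sum>e\<in>\<A>. \<Prod>x\<in>e. f x)"
    if "finite \<A>" "\<forall>e\<in>\<A>. finite e" for \<A>
  proof (rule sum.mono_neutral_left[OF that(1) avoid_subset], rule ballI)
    fix e assume "e \<in> \<A> - avoid {a} \<A>"
    then show "(\<Prod>x\<in>e. f x) = 0"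
      using assms(4) that(2) unfolding avoid_def by (intro prod_zero) auto
  qed
  then show ?thesis using assms(1-3) unfolding qform_def by simp
qed

text \<open>Functions vanishing at \<open>a\<close> do not see the sets containing \<open>a\<close>,
  and they form a subspace of codimension at most 1. The proof is one elimination step.\<close>

lemma neg_dim_avoid_vertex:
  assumes fin: "finite E" "finite P" "\<forall>e\<in>E \<union> P. finite e" and "neg_dim E P d"
  shows "neg_dim (avoid {a} E) (avoid {a} P) (d - 1)"
proof -
  obtain J :: "nat set" and F where J: "finite J" "card J = d"
    and neg: "\<And>c. \<exists>i\<in>J. c i \<noteq> 0 \<Longrightarrow> qform E P (\<lambda>x. \<Sum>i\<in>J. c i * F i x) < 0"
    using assms(4) unfolding neg_dim_def by blast
  show ?thesis
  proof (cases "J = {}")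
    case True
    then show ?thesis using J neg_dim_0 by auto
  next
    case False
    \<comment> \<open>The pivot is a basis function not vanishing at \<open>a\<close>. If there is
      none, \<open>j\<close> is arbitrary, and as division by zero gives 0, the other functions stay
      unchanged.\<close>
    then obtain j where j: "j \<in> J" "F j a = 0 \<longrightarrow> (\<forall>i\<in>J. F i a = 0)" by blast
    define F' where "F' i x = F i x - F i a / F j a * F j x" for i x
    have "qform (avoid {a} E) (avoid {a} P) (\<lambda>x. \<Sum>i\<in>J - {j}. c i * F' i x) < 0"
      if c: "\<exists>i\<in>J - {j}. c i \<noteq> 0" for c
    proof -
      define c' where "c' i = (if i = j then - (\<Sum>i\<in>J - {j}. c i * (F i a / F j a)) else c i)" for i
      have eq: "(\<Sum>i\<in>J - {j}. c i * F' i x) = (\<Sum>i\<in>J. c' i * F i x)" for x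
      proof -
        have "(\<Sum>i\<in>J. c' i * F i x) = c' j * F j x + (\<Sum>i\<in>J - {j}. c i * F i x)"
          using sum.remove[OF J(1) j(1), of "\<lambda>i. c' i * F i x"] unfolding c'_def by simp
        also have "c' j * F j x = - (\<Sum>i\<in>J - {j}. c i * (F i a / F j a) * F j x)"
          unfolding c'_def by (simp add: sum_distrib_right)
        finally show ?thesis unfolding F'_def
          by (simp add: right_diff_distrib sum_subtractf mult.assoc)
      qed
      have "(\<Sum>i\<in>J - {j}. c i * F' i a) = 0"
        using j(2) unfolding F'_def by (intro sum.neutral) auto
      then have "qform (avoid {a} E) (avoid {a} P) (\<lambda>x. \<Sum>i\<in>J - {j}. c i * F' i x)
          = qform E P (\<lambda>x. \<Sum>i\<in>J - {j}. c i * F' i x)"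
        by (rule qform_avoid[OF fin])
      also have "\<dots> = qform E P (\<lambda>x. \<Sum>i\<in>J. c' i * F i x)" unfolding eq ..
      also have "\<dots> < 0"
      proof (rule neg)
        show "\<exists>i\<in>J. c' i \<noteq> 0" using c unfolding c'_def by (metis DiffE singletonI)
      qed
      finally show ?thesis .
    qed
    moreover have "finite (J - {j})" "card (J - {j}) = d - 1" using J j(1) by auto
    ultimately show ?thesis unfolding neg_dim_def by (intro exI[of _ "J - {j}"] exI[of _ F']) simp
  qed
qed

lemma neg_dim_avoid:
  assumes "finite S" and fin: "finite E" "finite P" "\<forall>e\<in>E \<union> P. finite e" and "neg_dim E P d"
  shows "neg_dim (avoid S E) (avoid S P) (d - card S)"
  using assms(1)
proof (induction S rule: finite_induct)
  case empty
  then show ?case using assms(5) unfolding avoid_def by simp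
next
  case (insert a S)
  have eq: "avoid (insert a S) \<A> = avoid {a} (avoid S \<A>)" for \<A> :: "'a set set"
    unfolding avoid_def by blast
  have "finite (avoid S E)" "finite (avoid S P)" "\<forall>e\<in>avoid S E \<union> avoid S P. finite e"
    using fin unfolding avoid_def by auto
  from neg_dim_avoid_vertex[OF this insert.IH, of a] show ?case
    unfolding eq using insert.hyps by simp
qed

text \<open>On functions vanishing on a cover \<open>S\<close> the form is zero, so no negative
  direction survives the loss of \<open>card S\<close> dimensions.\<close>

lemma neg_dim_le_card_cover:
  assumes "finite S" "finite E" "finite P" "\<forall>e\<in>E \<union> P. finite e" "neg_dim E P d"
    and "avoid S E = {}" "avoid S P = {}"
  shows "d \<le> card S"
proof (rule ccontr)
  assume "\<not> d \<le> card S"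
  moreover have "neg_dim ({} :: 'a set set) {} (d - card S)" using neg_dim_avoid[OF assms(1-5)] assms(6,7) by simp
  then obtain J :: "nat set" and F where J: "card J = d - card S"
    and neg: "\<And>c. \<exists>i\<in>J. c i \<noteq> 0 \<Longrightarrow> qform ({} :: 'a set set) {} (\<lambda>x. \<Sum>i\<in>J. c i * F i x) < 0"
    unfolding neg_dim_def by blast
  ultimately have "\<exists>i\<in>J. (1::real) \<noteq> 0" by (metis card.empty diff_is_0_eq ex_in_conv zero_neq_one)
  from neg[of "\<lambda>_. 1", OF this] show False unfolding qform_def by simp
qed

text \<open>\<open>(\<Sum>A)(\<Sum>B) = u (\<Sum>A) + v (\<Sum>B) - u v + (u - \<Sum>B) (v - \<Sum>A)\<close>: a step changes the form by
  a hyperbolic plane.\<close>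

lemma qform_split_by:
  assumes fin: "finite E" "finite P" "\<forall>e\<in>E. e \<subseteq> V" "\<forall>p\<in>P. p \<subseteq> V"
    and AB: "finite A" "finite B" "A \<inter> B = {}" "A \<subseteq> V" "B \<subseteq> V"
    and uv: "u \<notin> V" "v \<notin> V" "u \<noteq> v"
    and sub: "joins ((\<lambda>x. {x}) ` A) ((\<lambda>x. {x}) ` B) \<subseteq> E"
  shows "qform (split_by E ((\<lambda>x. {x}) ` A) ((\<lambda>x. {x}) ` B) u v) (insert {u, v} P) f =
    qform E P f - (f u - sum f B) * (f v - sum f A)"
proof -
  let ?J = "joins ((\<lambda>x. {x}) ` A) ((\<lambda>x. {x}) ` B)"
  let ?g = "\<lambda>e. \<Prod>x\<in>e. f x"
  have uvAB: "u \<notin> A" "u \<notin> B" "v \<notin> A" "v \<notin> B" using AB uv by auto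
  have J: "?J = (\<lambda>(x, y). {x, y}) ` (A \<times> B)" unfolding joins_def by auto
  have inj: "inj_on (\<lambda>(x, y). {x, y}) (A \<times> B)"
    using AB(3) by (auto simp: inj_on_def doubleton_eq_iff)
  have "sum ?g ?J = (\<Sum>(x, y)\<in>A \<times> B. ?g {x, y})"
    unfolding J sum.reindex[OF inj] by (intro sum.cong) auto
  also have "\<dots> = (\<Sum>(x, y)\<in>A \<times> B. f x * f y)"
  proof (intro sum.cong refl, clarify)
    fix x y assume "x \<in> A" "y \<in> B"
    then have "x \<noteq> y" using AB(3) by blast
    then show "?g {x, y} = f x * f y" by (rule prod_doubleton)
  qed
  also have "\<dots> = sum f A * sum f B"
    by (simp add: sum_product sum.cartesian_product)
  finally have sJ: "sum ?g ?J = sum f A * sum f B" .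
  have inj1: "inj_on (\<lambda>x. {x, w}) X" if "w \<notin> X" for w :: 'a and X
    using that by (auto simp: inj_on_def doubleton_eq_iff)
  have sp: "sum ?g ((\<lambda>x. {x, w}) ` X) = f w * sum f X" if "w \<notin> X" "finite X" for w X
  proof -
    have "sum ?g ((\<lambda>x. {x, w}) ` X) = (\<Sum>x\<in>X. f w * f x)"
      unfolding sum.reindex[OF inj1[OF that(1)]] o_def
    proof (intro sum.cong refl)
      fix x assume "x \<in> X"
      then have "w \<noteq> x" using that(1) by blast
      then show "?g {x, w} = f w * f x" unfolding insert_commute[of x w] by (rule prod_doubleton)
    qed
    then show ?thesis by (simp add: sum_distrib_left)
  qed
  have im: "insert w ` (\<lambda>x. {x}) ` X = (\<lambda>x. {x, w}) ` X" for w :: 'a and X by auto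
  have d1: "(E - ?J) \<inter> (\<lambda>x. {x, u}) ` A = {}" using fin(3) uv by auto
  have d2: "((E - ?J) \<union> (\<lambda>x. {x, u}) ` A) \<inter> (\<lambda>x. {x, v}) ` B = {}"
    using fin(3) uv uvAB by (auto simp: doubleton_eq_iff)
  have "sum ?g (split_by E ((\<lambda>x. {x}) ` A) ((\<lambda>x. {x}) ` B) u v) =
      sum ?g (E - ?J) + sum ?g ((\<lambda>x. {x, u}) ` A) + sum ?g ((\<lambda>x. {x, v}) ` B)"
    unfolding split_by_def im using fin(1) AB(1,2)
    by (subst sum.union_disjoint[OF _ _ d2], simp, simp, subst sum.union_disjoint[OF _ _ d1]) simp_all
  also have "\<dots> = sum ?g E - sum f A * sum f B + f u * sum f A + f v * sum f B"
    using sum_diff[OF fin(1) sub, of ?g] sJ sp[OF uvAB(1) AB(1)] sp[OF uvAB(4) AB(2)] by simp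
  finally have E: "sum ?g (split_by E ((\<lambda>x. {x}) ` A) ((\<lambda>x. {x}) ` B) u v) =
    sum ?g E - sum f A * sum f B + f u * sum f A + f v * sum f B" .
  have "{u, v} \<notin> P" using fin(4) uv by blast
  then have "sum ?g (insert {u, v} P) = f u * f v + sum ?g P" using fin(2) uv(3) by simp
  then show ?thesis unfolding qform_def E by (simp add: algebra_simps)
qed

lemma qform_cong:
  assumes "\<forall>e\<in>E \<union> P. e \<subseteq> V" "\<And>x. x \<in> V \<Longrightarrow> f x = g x"
  shows "qform E P f = qform E P g"
proof -
  have "(\<Prod>x\<in>e. f x) = (\<Prod>x\<in>e. g x)" if "e \<in> E \<union> P" for e
    using that assms by (intro prod.cong) auto
  then show ?thesis unfolding qform_def by simp
qed

text \<open>Old functions are extended by their sum over \<open>B\<close> at \<open>u\<close> and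
  over \<open>A\<close> at \<open>v\<close>, which makes the correction term of
  \<open>qform_split_by\<close> vanish. The additional basis function is the indicator of
  \<open>{u, v}\<close>; with coefficient \<open>c j\<close> it contributes
  \<open>- c j * c j\<close>.\<close>

lemma neg_dim_split_by:
  assumes fin: "finite E" "finite P" "\<forall>e\<in>E. e \<subseteq> V" "\<forall>p\<in>P. p \<subseteq> V"
    and AB: "finite A" "finite B" "A \<inter> B = {}" "A \<subseteq> V" "B \<subseteq> V"
    and uv: "u \<notin> V" "v \<notin> V" "u \<noteq> v"
    and sub: "joins ((\<lambda>x. {x}) ` A) ((\<lambda>x. {x}) ` B) \<subseteq> E"
    and two: "\<forall>e\<in>E \<union> P. card e = 2" and "neg_dim E P d"
  shows "neg_dim (split_by E ((\<lambda>x. {x}) ` A) ((\<lambda>x. {x}) ` B) u v) (insert {u, v} P) (Suc d)"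
proof -
  obtain J :: "nat set" and F where J: "finite J" "card J = d"
    and neg: "\<And>c. \<exists>i\<in>J. c i \<noteq> 0 \<Longrightarrow> qform E P (\<lambda>x. \<Sum>i\<in>J. c i * F i x) < 0"
    using assms(15) unfolding neg_dim_def by blast
  obtain j where j: "j \<notin> J" using J(1) ex_new_if_finite[OF infinite_UNIV_nat] by blast
  define F' where "F' i = (if i = j then (\<lambda>x. if x = u \<or> x = v then 1 else 0)
    else (F i)(u := sum (F i) B, v := sum (F i) A))" for i
  have "qform (split_by E ((\<lambda>x. {x}) ` A) ((\<lambda>x. {x}) ` B) u v) (insert {u, v} P)
      (\<lambda>x. \<Sum>i\<in>insert j J. c i * F' i x) < 0" (is "?q < 0") if c: "\<exists>i\<in>insert j J. c i \<noteq> 0" for c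
  proof -
    let ?f = "\<lambda>x. \<Sum>i\<in>insert j J. c i * F' i x" and ?g = "\<lambda>x. \<Sum>i\<in>J. c i * F i x"
    have ins: "?f x = c j * F' j x + (\<Sum>i\<in>J. c i * ((F i)(u := sum (F i) B, v := sum (F i) A)) x)" for x
    proof -
      have "(\<Sum>i\<in>J. c i * F' i x) = (\<Sum>i\<in>J. c i * ((F i)(u := sum (F i) B, v := sum (F i) A)) x)"
        using j unfolding F'_def by (intro sum.cong) auto
      then show ?thesis using j J(1) by simp
    qed
    have f: "?f x = ?g x" if "x \<in> V" for x
      unfolding ins using that uv by (auto simp: F'_def)
    have sums: "sum ?f X = (\<Sum>i\<in>J. c i * sum (F i) X)" if "X \<subseteq> V" for X
    proof -
      have "sum ?f X = sum ?g X" by (rule sum.cong[OF refl], rule f) (use that in blast)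
      also have "\<dots> = (\<Sum>i\<in>J. c i * sum (F i) X)"
        by (subst sum.swap) (simp add: sum_distrib_left)
      finally show ?thesis .
    qed
    have fu: "?f u = c j + sum ?f B" unfolding sums[OF AB(5)] using ins[of u] uv(3) by (simp add: F'_def)
    have fv: "?f v = c j + sum ?f A" unfolding sums[OF AB(4)] using ins[of v] uv(3) by (simp add: F'_def)
    have "?q = qform E P ?f - (?f u - sum ?f B) * (?f v - sum ?f A)"
      by (rule qform_split_by[OF fin AB uv sub])
    also have "qform E P ?f = qform E P ?g"
      by (rule qform_cong[of _ _ V]) (use fin f in auto)
    also have "(?f u - sum ?f B) * (?f v - sum ?f A) = c j * c j" unfolding fu fv by simp
    finally have q: "?q = qform E P ?g - c j * c j" .
    show ?thesis
    proof (cases "\<exists>i\<in>J. c i \<noteq> 0")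
      case True
      then show ?thesis using neg[OF True] q by (smt (verit) zero_le_square)
    next
      case False
      then have "?g = (\<lambda>x. 0)" by auto
      moreover have "qform E P (\<lambda>x. 0) = 0"
        unfolding qform_def using two by (simp add: sum.neutral)
      moreover have "c j \<noteq> 0" using c False by blast
      ultimately show ?thesis using q by (auto simp: zero_less_mult_iff linorder_neq_iff)
    qed
  qed
  moreover have "finite (insert j J)" "card (insert j J) = Suc d" using J j by auto
  ultimately show ?thesis unfolding neg_dim_def by (intro exI[of _ "insert j J"] exI[of _ F']) simp
qed

section \<open>The negative definite space of the complete graph\<close>

lemma sum_pairs:
  fixes f :: "'a \<Rightarrow> real"
  assumes "finite V"
  shows "2 * (\<Sum>e | e \<subseteq> V \<and> card e = 2. \<Prod>x\<in>e. f x) = (sum f V)\<^sup>2 - (\<Sum>x\<in>V. (f x)\<^sup>2)"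
  using assms
proof (induction V rule: finite_induct)
  case empty
  have "{e :: 'a set. e \<subseteq> {} \<and> card e = 2} = {}" by auto
  then show ?case by (simp only: sum.empty) simp
next
  case (insert a V)
  have eq: "{e. e \<subseteq> insert a V \<and> card e = 2} = {e. e \<subseteq> V \<and> card e = 2} \<union> (\<lambda>y. {a, y}) ` V"
  proof (intro equalityI subsetI)
    fix e assume e: "e \<in> {e. e \<subseteq> insert a V \<and> card e = 2}"
    then obtain x y where "e = {x, y}" "x \<noteq> y" by (auto simp: card_2_iff)
    then show "e \<in> {e. e \<subseteq> V \<and> card e = 2} \<union> (\<lambda>y. {a, y}) ` V" using e by auto
  next
    fix e assume "e \<in> {e. e \<subseteq> V \<and> card e = 2} \<union> (\<lambda>y. {a, y}) ` V"
    moreover have "card {a, y} = 2" if "y \<in> V" for y using that insert.hyps by (auto simp: card_2_iff)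
    ultimately show "e \<in> {e. e \<subseteq> insert a V \<and> card e = 2}" by blast
  qed
  have dis: "{e. e \<subseteq> V \<and> card e = 2} \<inter> (\<lambda>y. {a, y}) ` V = {}" using insert.hyps by auto
  have "finite {e. e \<subseteq> V \<and> card e = 2}" using insert.hyps by simp
  then have "(\<Sum>e | e \<subseteq> insert a V \<and> card e = 2. \<Prod>x\<in>e. f x) =
      (\<Sum>e | e \<subseteq> V \<and> card e = 2. \<Prod>x\<in>e. f x) + (\<Sum>e\<in>(\<lambda>y. {a, y}) ` V. \<Prod>x\<in>e. f x)"
    unfolding eq using insert.hyps by (intro sum.union_disjoint[OF _ _ dis]) auto
  also have "(\<Sum>e\<in>(\<lambda>y. {a, y}) ` V. \<Prod>x\<in>e. f x) = (\<Sum>y\<in>V. f a * f y)"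
  proof -
    have "inj_on (\<lambda>y. {a, y}) V" by (auto simp: inj_on_def doubleton_eq_iff)
    then have "(\<Sum>e\<in>(\<lambda>y. {a, y}) ` V. \<Prod>x\<in>e. f x) = (\<Sum>y\<in>V. \<Prod>x\<in>{a, y}. f x)"
      by (subst sum.reindex) (simp_all only: o_def)
    also have "\<dots> = (\<Sum>y\<in>V. f a * f y)"
      using insert.hyps by (intro sum.cong refl prod_doubleton) auto
    finally show ?thesis .
  qed
  also have "\<dots> = f a * sum f V" by (simp add: sum_distrib_left)
  finally show ?case using insert by (simp add: power2_eq_square algebra_simps)
qed

text \<open>On functions with sum zero the form is minus half the sum of squares. The differences of
  the indicators of \<open>h i\<close> and \<open>w\<close> are a basis of this hyperplane.\<close>

lemma neg_dim_complete:
  assumes V: "finite V"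
  shows "neg_dim {e. e \<subseteq> V \<and> card e = 2} {} (card V - 1)"
proof (cases "V = {}")
  case True
  then show ?thesis using neg_dim_0 by simp
next
  case False
  then obtain w where w: "w \<in> V" by blast
  have fin: "finite (V - {w})" using V by simp
  obtain h :: "nat \<Rightarrow> 'a" where h: "bij_betw h {0..<card (V - {w})} (V - {w})"
    using ex_bij_betw_nat_finite[OF fin] by blast
  define J where "J = {0..<card (V - {w})}"
  have J: "finite J" "card J = card V - 1" unfolding J_def using V w by auto
  have hJ: "h i \<in> V" "h i \<noteq> w" if "i \<in> J" for i using h that unfolding J_def bij_betw_def by auto
  have inj: "h i = h k \<longleftrightarrow> i = k" if "i \<in> J" "k \<in> J" for i k
    using h that unfolding J_def bij_betw_def inj_on_def by blast
  define F where "F i x = (if x = h i then 1 else 0) - (if x = w then 1 else (0::real))" for i x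
  have "qform {e. e \<subseteq> V \<and> card e = 2} {} (\<lambda>x. \<Sum>i\<in>J. c i * F i x) < 0"
    if c: "\<exists>i\<in>J. c i \<noteq> 0" for c
  proof -
    let ?f = "\<lambda>x. \<Sum>i\<in>J. c i * F i x"
    obtain k where k: "k \<in> J" "c k \<noteq> 0" using c by blast
    have "sum (F i) V = 0" if "i \<in> J" for i
      unfolding F_def sum_subtractf using V w hJ[OF that] by simp
    then have "sum ?f V = 0" by (subst sum.swap) (simp add: sum_distrib_left[symmetric])
    moreover have "?f (h k) = c k"
    proof -
      have "?f (h k) = (\<Sum>i\<in>J. if i = k then c i else 0)"
        using hJ(2)[OF k(1)] inj[OF k(1)] unfolding F_def by (intro sum.cong) auto
      then show ?thesis using J(1) k(1) by simp
    qed
    then have "(\<Sum>x\<in>V. (?f x)\<^sup>2) > 0"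
      using k hJ(1)[OF k(1)] V by (intro sum_pos2[of _ "h k"]) auto
    ultimately show ?thesis using sum_pairs[OF V, of ?f] unfolding qform_def by simp
  qed
  then show ?thesis using J unfolding neg_dim_def by (intro exI[of _ J] exI[of _ F]) simp
qed

section \<open>Graphs with paired vertices\<close>

text \<open>The vertices added by a step form a pair. A transversal \<open>I\<close> of the pairs without an
  edge inside corresponds to a satisfying assignment.\<close>

definition paired_graph :: "'a set \<Rightarrow> 'a set set \<Rightarrow> 'a set set \<Rightarrow> bool" where
  "paired_graph V E P \<longleftrightarrow> finite V \<and> (\<forall>e\<in>E \<union> P. e \<subseteq> V \<and> card e = 2) \<and>
     (\<forall>p\<in>P. \<forall>q\<in>P. p \<noteq> q \<longrightarrow> p \<inter> q = {}) \<and> E \<inter> P = {} \<and>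
     (\<forall>x y z. {x, y} \<in> P \<and> {x, z} \<in> E \<longrightarrow> {y, z} \<notin> E) \<and>
     (\<exists>I. (\<forall>e\<in>E. \<not> e \<subseteq> I) \<and> (\<forall>p\<in>P. card (p \<inter> I) = 1))"

lemma paired_graphD:
  assumes "paired_graph V E P"
  shows "finite V" "finite E" "finite P" "\<And>e. e \<in> E \<Longrightarrow> e \<subseteq> V" "\<And>p. p \<in> P \<Longrightarrow> p \<subseteq> V"
    "\<And>e. e \<in> E \<Longrightarrow> card e = 2" "\<And>p. p \<in> P \<Longrightarrow> card p = 2" "\<forall>e\<in>E \<union> P. finite e" "\<Union>E \<subseteq> V"
proof -
  show V: "finite V" and E: "\<And>e. e \<in> E \<Longrightarrow> e \<subseteq> V" and P: "\<And>p. p \<in> P \<Longrightarrow> p \<subseteq> V"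
    and "\<And>e. e \<in> E \<Longrightarrow> card e = 2" "\<And>p. p \<in> P \<Longrightarrow> card p = 2"
    using assms unfolding paired_graph_def by auto
  show "finite E" "finite P" using finite_subset[of _ "Pow V"] V E P by auto
  show "\<forall>e\<in>E \<union> P. finite e" using finite_subset[OF _ V] E P by blast
  show "\<Union>E \<subseteq> V" using E by blast
qed

lemma paired_graph_pairs:
  assumes "paired_graph V E P"
  shows "\<forall>p\<in>P. \<forall>q\<in>P. p \<noteq> q \<longrightarrow> p \<inter> q = {}" "E \<inter> P = {}"
    "\<forall>x y z. {x, y} \<in> P \<and> {x, z} \<in> E \<longrightarrow> {y, z} \<notin> E"
    "\<exists>I. (\<forall>e\<in>E. \<not> e \<subseteq> I) \<and> (\<forall>p\<in>P. card (p \<inter> I) = 1)"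
proof -
  note a = assms[unfolded paired_graph_def]
  show "\<forall>p\<in>P. \<forall>q\<in>P. p \<noteq> q \<longrightarrow> p \<inter> q = {}" using a by (elim conjE)
  show "E \<inter> P = {}" using a by (elim conjE)
  show "\<forall>x y z. {x, y} \<in> P \<and> {x, z} \<in> E \<longrightarrow> {y, z} \<notin> E" using a by (elim conjE)
  show "\<exists>I. (\<forall>e\<in>E. \<not> e \<subseteq> I) \<and> (\<forall>p\<in>P. card (p \<inter> I) = 1)" using a by (elim conjE)
qed

lemma paired_graph_avoid:
  assumes "paired_graph V E P"
  shows "paired_graph (V - L) (avoid L E) (avoid L P)"
proof -
  obtain I where "\<forall>e\<in>E. \<not> e \<subseteq> I" "\<forall>p\<in>P. card (p \<inter> I) = 1" using paired_graph_pairs(4)[OF assms] by auto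
  then have "\<forall>e\<in>avoid L E. \<not> e \<subseteq> I" "\<forall>p\<in>avoid L P. card (p \<inter> I) = 1"
    using avoid_subset by (metis subsetD)+
  then have I: "\<exists>I. (\<forall>e\<in>avoid L E. \<not> e \<subseteq> I) \<and> (\<forall>p\<in>avoid L P. card (p \<inter> I) = 1)"
    by (intro exI[of _ I] conjI)
  note pairs = paired_graph_pairs[OF assms]
  note D = paired_graphD[OF assms]
  show ?thesis unfolding paired_graph_def
  proof (intro conjI I)
    show "\<forall>p\<in>avoid L P. \<forall>q\<in>avoid L P. p \<noteq> q \<longrightarrow> p \<inter> q = {}" "avoid L E \<inter> avoid L P = {}"
      using pairs(1,2) unfolding avoid_def by auto
    show "\<forall>x y z. {x, y} \<in> avoid L P \<and> {x, z} \<in> avoid L E \<longrightarrow> {y, z} \<notin> avoid L E"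
      using pairs(3) unfolding avoid_def mem_Collect_eq by metis
    show "\<forall>e\<in>avoid L E \<union> avoid L P. e \<subseteq> V - L \<and> card e = 2"
    proof
      fix e assume "e \<in> avoid L E \<union> avoid L P"
      then have "e \<in> E \<union> P" "e \<inter> L = {}" unfolding avoid_def by auto
      then show "e \<subseteq> V - L \<and> card e = 2" using D(4-7)[of e] by blast
    qed
  qed (use D(1) in simp)
qed

text \<open>A pair never acquires a common neighbour: \<open>u\<close> and \<open>v\<close> see the
  disjoint sets \<open>A\<close> and \<open>B\<close>, and an old pair inside one of these already
  had every vertex of the other as a common neighbour.\<close>

lemma paired_graph_split_by:
  assumes st: "paired_graph V E P" and s: "splittable V E ((\<lambda>x. {x}) ` A) ((\<lambda>x. {x}) ` B) u v"
  shows "A \<subseteq> V" "B \<subseteq> V" "A \<inter> B = {}"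
    "paired_graph (V \<union> {u, v}) (split_by E ((\<lambda>x. {x}) ` A) ((\<lambda>x. {x}) ` B) u v) (insert {u, v} P)"
proof -
  note D = paired_graphD[OF st]
  let ?E = "split_by E ((\<lambda>x. {x}) ` A) ((\<lambda>x. {x}) ` B) u v"
  have uv: "u \<notin> V" "v \<notin> V" "u \<noteq> v" using s unfolding splittable_def by auto
  have ne: "A \<noteq> {}" "B \<noteq> {}" using s unfolding splittable_def by auto
  show AV: "A \<subseteq> V" and BV: "B \<subseteq> V" using splittable_subset[OF s D(9)] by auto
  have AB: "{x, y} \<in> E" if "x \<in> A" "y \<in> B" for x y
    using splittable_Un[OF s, of "{x}" "{y}"] that by (auto simp: insert_commute)
  have E2: "x \<noteq> y" if "{x, y} \<in> E" for x y using D(6)[OF that] by auto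
  show dis: "A \<inter> B = {}" using AB E2 by blast
  have E: "e \<in> ?E \<longleftrightarrow> (e \<in> E \<and> \<not> (\<exists>x\<in>A. \<exists>y\<in>B. e = {x, y})) \<or> (\<exists>x\<in>A. e = {u, x}) \<or> (\<exists>x\<in>B. e = {v, x})" for e
    unfolding split_by_def joins_def by auto
  have c1: "e \<subseteq> V \<union> {u, v} \<and> card e = 2" if "e \<in> ?E \<union> insert {u, v} P" for e
  proof -
    have "u \<noteq> x" "v \<noteq> x" if "x \<in> V" for x using that uv by auto
    then show ?thesis using that AV BV D(4-7) uv(3) unfolding Un_iff E insert_iff
      by (elim disjE conjE bexE) (auto simp: subset_iff card_2_iff)
  qed
  have c2: "p \<inter> q = {}" if "p \<in> insert {u, v} P" "q \<in> insert {u, v} P" "p \<noteq> q" for p q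
  proof -
    have "p \<inter> q = {}" if "p \<in> P" "q \<in> P" "p \<noteq> q" for p q using paired_graph_pairs(1-3)[OF st] that by blast
    moreover have "p \<inter> {u, v} = {}" if "p \<in> P" for p using D(5)[OF that] uv by blast
    ultimately show ?thesis using that by (metis Int_commute insertE)
  qed
  have c3: "?E \<inter> insert {u, v} P = {}"
  proof -
    have "{u, v} \<notin> ?E" unfolding E using D(4) uv AV BV by (auto simp: doubleton_eq_iff)
    moreover have "p \<notin> ?E" if "p \<in> P" for p
    proof -
      have "p \<notin> E" using paired_graph_pairs(1-3)[OF st] that by blast
      then show ?thesis unfolding E using D(5)[OF that] uv by blast
    qed
    ultimately show ?thesis by blast
  qed
  have c4: "{y, z} \<notin> ?E" if xy: "{x, y} \<in> insert {u, v} P" and xz: "{x, z} \<in> ?E" for x y z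
  proof
    assume yz: "{y, z} \<in> ?E"
    have nb: "{y, z} \<notin> E" if "{x, y} \<in> P" "{x, z} \<in> E" for x y z
      using paired_graph_pairs(3)[OF st] that by metis
    have nu: "w \<in> A" if "{u, w} \<in> ?E" for w
      using that D(4) uv AV BV unfolding E by (auto simp: doubleton_eq_iff)
    have nv: "w \<in> B" if "{v, w} \<in> ?E" for w
      using that D(4) uv AV BV unfolding E by (auto simp: doubleton_eq_iff)
    show False
    proof (cases "{x, y} \<in> P")
      case True
      then have "x \<in> V" "y \<in> V" using D(5) by auto
      consider "z = u" | "z = v" | "z \<noteq> u" "z \<noteq> v" by blast
      then show False
      proof cases
        case 1
        then have "x \<in> A" "y \<in> A" using nu xz yz by (auto simp: insert_commute)
        moreover obtain b where "b \<in> B" using ne by blast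
        ultimately show False using AB nb[OF True] by blast
      next
        case 2
        then have "x \<in> B" "y \<in> B" using nv xz yz by (auto simp: insert_commute)
        moreover obtain b where "b \<in> A" using ne by blast
        ultimately show False using AB[of b] nb[OF True, of b] by (metis insert_commute)
      next
        case 3
        then have "{x, z} \<in> E" "{y, z} \<in> E"
          using xz yz \<open>x \<in> V\<close> \<open>y \<in> V\<close> uv unfolding E by (auto simp: doubleton_eq_iff)
        then show False using nb[OF True] by blast
      qed
    next
      case False
      then have "x = u \<and> y = v \<or> x = v \<and> y = u" using xy by (simp add: doubleton_eq_iff)
      then have "z \<in> A \<and> z \<in> B" using nu[of z] nv[of z] xz yz by metis
      then show False using dis by blast
    qed
  qed
  have c5: "\<exists>I. (\<forall>e\<in>?E. \<not> e \<subseteq> I) \<and> (\<forall>p\<in>insert {u, v} P. card (p \<inter> I) = 1)"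
  proof -
    obtain I where I: "\<forall>e\<in>E. \<not> e \<subseteq> I" "\<forall>p\<in>P. card (p \<inter> I) = 1" using paired_graph_pairs(4)[OF st] by auto
    \<comment> \<open>If both sides met \<open>I\<close>, an edge between them would lie in
      \<open>I\<close>. So one of \<open>u\<close> and \<open>v\<close> can join the transversal
      without completing an edge.\<close>
    define w where "w = (if A \<inter> I = {} then u else v)"
    have w: "w = u \<and> A \<inter> I = {} \<or> w = v \<and> B \<inter> I = {}"
    proof (cases "A \<inter> I = {}")
      case False
      then obtain x where x: "x \<in> A" "x \<in> I" by blast
      have "y \<notin> I" if "y \<in> B" for y using bspec[OF I(1) AB[OF x(1) that]] x(2) by simp
      then show ?thesis using False unfolding w_def by auto
    qed (simp add: w_def)
    have wV: "w \<notin> V" using w uv by blast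
    let ?I = "insert w (I \<inter> V)"
    have "p \<inter> ?I = p \<inter> I" if "p \<in> P" for p using D(5)[OF that] wV by blast
    moreover have "{u, v} \<inter> ?I = {w}" using w uv by blast
    ultimately have "\<forall>p\<in>insert {u, v} P. card (p \<inter> ?I) = 1" using I(2) by simp
    moreover have "\<not> e \<subseteq> ?I" if "e \<in> ?E" for e
      using that unfolding E
    proof (elim disjE conjE bexE)
      assume "e \<in> E"
      then show ?thesis using I(1) D(4)[of e] wV by blast
    next
      fix x assume "x \<in> A" "e = {u, x}"
      then show ?thesis using w uv AV by auto
    next
      fix x assume "x \<in> B" "e = {v, x}"
      then show ?thesis using w uv BV by auto
    qed
    ultimately show ?thesis by blast
  qed
  show "paired_graph (V \<union> {u, v}) ?E (insert {u, v} P)"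
    unfolding paired_graph_def
  proof (intro conjI c3 c5 ballI allI impI)
    show "finite (V \<union> {u, v})" using D(1) by simp
    show "e \<subseteq> V \<union> {u, v}" "card e = 2" if "e \<in> ?E \<union> insert {u, v} P" for e using c1[OF that] by auto
    show "p \<inter> q = {}" if "p \<in> insert {u, v} P" "q \<in> insert {u, v} P" "p \<noteq> q" for p q using c2[OF that] .
    show "{y, z} \<notin> ?E" if "{x, y} \<in> insert {u, v} P \<and> {x, z} \<in> ?E" for x y z using c4 that by blast
  qed
qed

lemma card_2_memE:
  assumes "card e = 2" "x \<in> e"
  obtains y where "e = {x, y}" "y \<noteq> x"
  using assms by (auto simp: card_2_iff)

text \<open>If every vertex is paired, \<open>V - I\<close> is half of \<open>V\<close>. It meets
  each edge, since none lies in \<open>I\<close>, and each pair, so it is a cover for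
  \<open>neg_dim_le_card_cover\<close>.\<close>

lemma neg_dim_le_pairs:
  assumes st: "paired_graph V E P" and neg: "neg_dim E P d" and V: "V \<subseteq> \<Union>P"
  shows "2 * d \<le> card V"
proof -
  note D = paired_graphD[OF st]
  obtain I where I: "\<forall>e\<in>E. \<not> e \<subseteq> I" "\<forall>p\<in>P. card (p \<inter> I) = 1" using paired_graph_pairs(4)[OF st] by auto
  have dis: "p \<inter> q = {}" if "p \<in> P" "q \<in> P" "p \<noteq> q" for p q using paired_graph_pairs(1)[OF st] that by blast
  have pV: "\<Union>P = V" using V D(5) by blast
  have fp: "finite p" if "p \<in> P" for p using D(8) that by blast
  have "card V = (\<Sum>p\<in>P. card p)"
    unfolding pV[symmetric] using D(3) fp dis by (intro card_Union_disjoint) (auto simp: pairwise_def disjnt_def)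
  then have cV: "card V = 2 * card P" using D(7) by simp
  have dis': "\<forall>p\<in>P. \<forall>q\<in>P. p \<noteq> q \<longrightarrow> (p - I) \<inter> (q - I) = {}" using dis by blast
  have "V - I = (\<Union>p\<in>P. p - I)" using pV by blast
  then have "card (V - I) = (\<Sum>p\<in>P. card (p - I))"
    using card_UN_disjoint[OF D(3), of "\<lambda>p. p - I"] fp dis' by simp
  also have "\<dots> = (\<Sum>p\<in>P. 1)"
  proof (rule sum.cong[OF refl])
    fix p assume p: "p \<in> P"
    have "card (p - I) = card p - card (p \<inter> I)" using fp[OF p] by (simp add: card_Diff_subset_Int)
    then show "card (p - I) = 1" using D(7) I(2) p by simp
  qed
  finally have cI: "card (V - I) = card P" by simp
  have "avoid (V - I) E = {}" using I(1) D(4) unfolding avoid_def by blast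
  moreover have "p \<inter> (V - I) \<noteq> {}" if "p \<in> P" for p
  proof
    assume "p \<inter> (V - I) = {}"
    then have "p \<inter> I = p" using D(5)[OF that] by blast
    then show False using D(7) I(2) that by auto
  qed
  then have "avoid (V - I) P = {}" unfolding avoid_def by blast
  ultimately have "d \<le> card (V - I)"
    using neg_dim_le_card_cover[OF _ D(2,3,8) neg] D(1) by blast
  then show ?thesis using cV cI by simp
qed

section \<open>A minimal counterexample\<close>

text \<open>In the measure \<open>3 * k + card V\<close> a step weighs more than the two vertices it
  adds. So the measure falls when the first step is absorbed into the graph, when a step is dropped,
  and when vertices are deleted.\<close>

locale minimal_counterexample =
  fixes V :: "'a set" and E P :: "'a set set" and d k :: nat and W' :: "'a set" and \<phi>' :: "'a set set"
  assumes graph: "paired_graph V E P" and neg: "neg_dim E P d"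
    and steps: "(step ^^ k) (V, E) (W', \<phi>')" and fin: "finite \<phi>'"
    and fails: "int (card \<phi>') < 3 * (2 * int d - int (card V))"
    and minimal: "\<And>(V1 :: 'a set) E1 P1 d1 k1 W1 \<psi>. 3 * k1 + card V1 < 3 * k + card V \<Longrightarrow>
      paired_graph V1 E1 P1 \<Longrightarrow> neg_dim E1 P1 d1 \<Longrightarrow> (step ^^ k1) (V1, E1) (W1, \<psi>) \<Longrightarrow>
      finite \<psi> \<Longrightarrow> 3 * (2 * int d1 - int (card V1)) \<le> int (card \<psi>)"
begin

lemmas graphD = paired_graphD[OF graph]

text \<open>Deleting \<open>S\<close> and then the vertices \<open>T\<close> isolated by this lowers the bound by at most
  \<open>3 (card S - card T)\<close>, so fewer clauses than that may be lost.\<close>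

lemma lost_clauses:
  assumes ST: "S \<union> T \<subseteq> V" "S \<union> T \<noteq> {}" "S \<inter> T = {}"
    and iso: "\<And>e. e \<in> E \<union> P \<Longrightarrow> e \<inter> T \<noteq> {} \<Longrightarrow> e \<inter> S \<noteq> {}"
    and m: "m \<le> k" "(step ^^ m) (V - (S \<union> T), avoid (S \<union> T) E) (V', \<psi>)"
    and H: "\<psi> \<subseteq> \<phi>'" "H \<subseteq> \<phi>'" "H \<inter> \<psi> = {}"
  shows "int (card H) < 3 * (int (card S) - int (card T))"
proof -
  have fS: "finite S" "finite T" using ST(1) graphD(1) by (auto intro: finite_subset)
  have eq: "avoid (S \<union> T) E = avoid S E" "avoid (S \<union> T) P = avoid S P"
    using iso unfolding avoid_def by auto
  have "neg_dim (avoid (S \<union> T) E) (avoid (S \<union> T) P) (d - card S)"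
    unfolding eq by (rule neg_dim_avoid[OF fS(1) graphD(2,3,8) neg])
  moreover have cST: "card (S \<union> T) = card S + card T" using card_Un_disjoint[OF fS ST(3)] .
  have cle: "card (S \<union> T) \<le> card V" using card_mono[OF graphD(1) ST(1)] .
  have cV: "card (V - (S \<union> T)) = card V - (card S + card T)"
    using card_Diff_subset[of "S \<union> T" V] fS ST(1) cST by simp
  have "card (S \<union> T) > 0" using ST(2) fS by (simp add: card_gt_0_iff)
  then have "3 * m + card (V - (S \<union> T)) < 3 * k + card V" using m(1) cV cST cle by linarith
  moreover have fpsi: "finite \<psi>" using fin H(1) by (rule finite_subset[rotated])
  ultimately have "3 * (2 * int (d - card S) - int (card (V - (S \<union> T)))) \<le> int (card \<psi>)"
    using minimal[OF _ paired_graph_avoid[OF graph] _ m(2)] by blast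
  moreover have "int (card H) + int (card \<psi>) \<le> int (card \<phi>')"
  proof -
    have fH: "finite H" using fin H(2) by (rule finite_subset[rotated])
    have "card (H \<union> \<psi>) \<le> card \<phi>'" using H by (intro card_mono[OF fin]) auto
    then show ?thesis using card_Un_disjoint[OF fH fpsi H(3)] by simp
  qed
  moreover have "int (card (V - (S \<union> T))) = int (card V) - int (card S) - int (card T)"
    using cV cle cST by simp
  \<comment> \<open>Truncated subtraction errs on the safe side.\<close>
  moreover have "int (d - card S) \<ge> int d - int (card S)" by simp
  ultimately show ?thesis using fails by (smt (verit))
qed

text \<open>A condition of Hall type, obtained from \<open>lost_clauses\<close> with no lost clause
  at all: otherwise the deletion would not lower the bound.\<close>

lemma card_isolated_less:
  assumes ST: "S \<union> T \<subseteq> V" "S \<union> T \<noteq> {}" "S \<inter> T = {}"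
    and iso: "\<And>e. e \<in> E \<union> P \<Longrightarrow> e \<inter> T \<noteq> {} \<Longrightarrow> e \<inter> S \<noteq> {}"
  shows "card T < card S"
proof -
  obtain m L' V' where "m \<le> k" "(step ^^ m) (V - (S \<union> T), avoid (S \<union> T) E) (V', avoid L' \<phi>')"
    using steps_avoid[OF steps graphD(9) ST(1), of "V - (S \<union> T)"] by blast
  from lost_clauses[OF assms this avoid_subset, of "{}"] show ?thesis by simp
qed

lemma pair_eq: "p = q" if "p \<in> P" "q \<in> P" "x \<in> p" "x \<in> q"
  using paired_graph_pairs(1)[OF graph] that by blast

text \<open>A vertex without edges is isolated by deleting its partner, or nothing if it has none;
  either contradicts \<open>card_isolated_less\<close>.\<close>

lemma not_isolated:
  assumes x: "x \<in> V"
  obtains e where "e \<in> E" "x \<in> e"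
proof (rule ccontr)
  assume "\<not> thesis"
  then have no: "\<And>e. e \<in> E \<Longrightarrow> x \<notin> e" using that by blast
  show False
  proof (cases "\<exists>p\<in>P. x \<in> p")
    case True
    then obtain p where p: "p \<in> P" "x \<in> p" by blast
    obtain y where y: "p = {x, y}" "y \<noteq> x" using card_2_memE[OF graphD(7)[OF p(1)] p(2)] .
    have "y \<in> V" using graphD(5)[OF p(1)] y by simp
    then have "card {x} < card {y}"
    proof (intro card_isolated_less)
      fix e assume "e \<in> E \<union> P" "e \<inter> {x} \<noteq> {}"
      then have "e = p" using no pair_eq[OF _ p(1) _ p(2)] by blast
      then show "e \<inter> {y} \<noteq> {}" using y by blast
    qed (use x y in auto)
    then show False by simp
  next
    case False
    have "card {x} < card ({} :: 'a set)"
      by (rule card_isolated_less) (use x no False in auto)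
    then show False by simp
  qed
qed

lemma leaf_paired:
  assumes ab: "{a, b} \<in> E" and leaf: "\<And>e. e \<in> E \<Longrightarrow> a \<in> e \<Longrightarrow> e = {a, b}"
  obtains a' where "{a, a'} \<in> P"
proof (rule ccontr)
  assume "\<not> thesis"
  then have no: "\<And>y. {a, y} \<notin> P" using that by blast
  have ne: "a \<noteq> b" using graphD(6)[OF ab] by auto
  have "card {a} < card {b}"
  proof (rule card_isolated_less)
    fix e assume e: "e \<in> E \<union> P" "e \<inter> {a} \<noteq> {}"
    have "e \<notin> P"
    proof
      assume "e \<in> P"
      then obtain y where "e = {a, y}" using card_2_memE[OF graphD(7)] e(2) by blast
      then show False using no \<open>e \<in> P\<close> by simp
    qed
    then show "e \<inter> {b} \<noteq> {}" using leaf e by blast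
  qed (use ne graphD(4)[OF ab] in auto)
  then show False by simp
qed

section \<open>Derivations of length zero\<close>

lemma pair_no_common_neighbour: "{y, z} \<notin> E" if "{x, y} \<in> P" "{x, z} \<in> E"
  using paired_graph_pairs(3)[OF graph] that by metis

lemma steps_nonempty: "k \<noteq> 0"
proof
  assume k: "k = 0"
  then have \<phi>': "\<phi>' = E" using steps by simp
  have hit: "int (card {e \<in> E. e \<inter> (S \<union> T) \<noteq> {}}) < 3 * (int (card S) - int (card T))"
    if "S \<union> T \<subseteq> V" "S \<union> T \<noteq> {}" "S \<inter> T = {}"
      "\<And>e. e \<in> E \<union> P \<Longrightarrow> e \<inter> T \<noteq> {} \<Longrightarrow> e \<inter> S \<noteq> {}" for S T
  proof -
    have "(step ^^ 0) (V - (S \<union> T), avoid (S \<union> T) E) (V - (S \<union> T), avoid (S \<union> T) E)" by simp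
    from lost_clauses[OF that _ this] show ?thesis unfolding \<phi>' by (simp add: avoid_def disjoint_iff)
  qed
  have atleast: "n \<le> card {e \<in> E. e \<inter> L \<noteq> {}}" if "X \<subseteq> {e \<in> E. e \<inter> L \<noteq> {}}" "card X = n" for X L n
    using card_mono[OF _ that(1)] graphD(2) that(2) by simp
  show False
  proof (cases "V \<subseteq> \<Union>P")
    case True
    then show False using neg_dim_le_pairs[OF graph neg] fails by simp
  next
    case False
    then obtain a where a: "a \<in> V" "\<And>p. p \<in> P \<Longrightarrow> a \<notin> p" by blast
    obtain e1 where e1: "e1 \<in> E" "a \<in> e1" using not_isolated[OF a(1)] .
    obtain x where x: "e1 = {a, x}" "x \<noteq> a" using card_2_memE[OF graphD(6)[OF e1(1)] e1(2)] .
    obtain e2 where e2: "e2 \<in> E" "a \<in> e2" "e2 \<noteq> e1"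
      using leaf_paired[of a x] e1(1) a(2) x by (metis insertI1)
    obtain y where y: "e2 = {a, y}" "y \<noteq> a" using card_2_memE[OF graphD(6)[OF e2(1)] e2(2)] .
    have xy: "x \<noteq> y" using e2(3) x y by blast
    have V: "x \<in> V" "y \<in> V" using graphD(4) e1(1) e2(1) x y by auto
    have only: "e = e1 \<or> e = e2" if "e \<in> E" "a \<in> e" for e
    proof (rule ccontr)
      assume "\<not> ?thesis"
      then have "3 \<le> card {e \<in> E. e \<inter> ({a} \<union> {}) \<noteq> {}}"
        using that e1 e2 by (intro atleast[of "{e, e1, e2}"]) auto
      then show False using hit[of "{a}" "{}"] a(1) by simp
    qed
    \<comment> \<open>One neighbour of \<open>a\<close> is a leaf: otherwise deleting both isolates
      the unpaired \<open>a\<close>, at a net cost of one vertex, and at least three edges are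
      lost.\<close>
    have "\<exists>z\<in>{x, y}. \<forall>e\<in>E. z \<in> e \<longrightarrow> e = {a, z}"
    proof (rule ccontr)
      assume "\<not> ?thesis"
      then obtain e3 where e3: "e3 \<in> E" "x \<in> e3" "e3 \<noteq> {a, x}" by blast
      have "a \<notin> e3" using only[OF e3(1)] e3 x y xy by auto
      then have "e3 \<noteq> e1" "e3 \<noteq> e2" using e1 e2 by auto
      then have "card {e1, e2, e3} = 3" using e2(3) by auto
      then have "3 \<le> card {e \<in> E. e \<inter> ({x, y} \<union> {a}) \<noteq> {}}"
        using e1 e2 e3 by (intro atleast[of "{e1, e2, e3}"]) auto
      moreover have "int (card {e \<in> E. e \<inter> ({x, y} \<union> {a}) \<noteq> {}}) < 3 * (int (card {x, y}) - int (card {a}))"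
      proof (rule hit)
        fix e assume "e \<in> E \<union> P" "e \<inter> {a} \<noteq> {}"
        then have "e = e1 \<or> e = e2" using only a(2) by blast
        then show "e \<inter> {x, y} \<noteq> {}" using x y by blast
      qed (use a V x y in auto)
      ultimately show False using xy by simp
    qed
    then obtain z where z: "z \<in> {x, y}" "\<And>e. e \<in> E \<Longrightarrow> z \<in> e \<Longrightarrow> e = {z, a}"
      by (metis insert_commute)
    have za: "{z, a} \<in> E" using z(1) e1(1) e2(1) x y by (auto simp: insert_commute)
    obtain w where w: "{z, w} \<in> P" using leaf_paired[OF za z(2)] .
    have wV: "w \<in> V" using graphD(5)[OF w] by simp
    have wz: "w \<noteq> z" using graphD(7)[OF w] by auto
    have wa: "w \<noteq> a" using a(2)[OF w] by blast
    \<comment> \<open>The pair \<open>{z, w}\<close> has no common neighbour, so an edge at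
      \<open>w\<close> is a third one besides \<open>e1\<close> and \<open>e2\<close>. Deleting
      \<open>a\<close> and \<open>w\<close> loses all three and isolates the leaf
      \<open>z\<close>.\<close>
    have "{w, a} \<notin> E" by (rule pair_no_common_neighbour[OF w za])
    then have wxy: "w \<noteq> x" "w \<noteq> y" using e1 e2 x y by (auto simp: insert_commute)
    obtain e3 where e3: "e3 \<in> E" "w \<in> e3" using not_isolated[OF wV] .
    have "3 \<le> card {e \<in> E. e \<inter> ({a, w} \<union> {z}) \<noteq> {}}"
    proof (rule atleast[of "{e1, e2, e3}"])
      have "e3 \<noteq> e1" "e3 \<noteq> e2" using e3(2) x y wxy wa by auto
      then show "card {e1, e2, e3} = 3" using e2(3) by auto
    qed (use e1 e2 e3 in auto)
    moreover have "int (card {e \<in> E. e \<inter> ({a, w} \<union> {z}) \<noteq> {}}) < 3 * (int (card {a, w}) - int (card {z}))"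
    proof (rule hit)
      fix e assume e: "e \<in> E \<union> P" "e \<inter> {z} \<noteq> {}"
      then have "e = {z, a} \<or> e = {z, w}" using z(2) pair_eq[OF _ w, of e z] by blast
      then show "e \<inter> {a, w} \<noteq> {}" by blast
    qed (use a wV wz wa z V x y in auto)
    ultimately show False using wa by simp
  qed
qed

text \<open>Absorbing the step adds 1 to \<open>d\<close> and 2 to \<open>card V\<close>: the bound
  stays and the measure falls. The continuation may end in any family that is no larger, since
  \<open>decide\<close> changes the final one.\<close>

lemma clean_step_False:
  assumes s: "splittable V E ((\<lambda>x. {x}) ` A) ((\<lambda>x. {x}) ` B) u v"
    and r: "(step ^^ j) (V \<union> {u, v}, split_by E ((\<lambda>x. {x}) ` A) ((\<lambda>x. {x}) ` B) u v) (W1, \<psi>)"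
    and \<psi>: "finite \<psi>" "card \<psi> \<le> card \<phi>'" and j: "j < k"
  shows False
proof -
  note st = paired_graph_split_by[OF graph s]
  have uv: "u \<notin> V" "v \<notin> V" "u \<noteq> v" and sub: "joins ((\<lambda>x. {x}) ` A) ((\<lambda>x. {x}) ` B) \<subseteq> E"
    using s unfolding splittable_def by auto
  have fAB: "finite A" "finite B" using finite_subset[OF _ graphD(1)] st(1,2) by auto
  have cV: "card (V \<union> {u, v}) = card V + 2" using uv graphD(1) by simp
  have "neg_dim (split_by E ((\<lambda>x. {x}) ` A) ((\<lambda>x. {x}) ` B) u v) (insert {u, v} P) (Suc d)"
    by (rule neg_dim_split_by[OF graphD(2,3) _ _ fAB st(3,1,2) uv sub _ neg]) (use graphD(4-7) in auto)
  from minimal[OF _ st(4) this r \<psi>(1)] cV j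
  have "3 * (2 * int (Suc d) - int (card V + 2)) \<le> int (card \<psi>)" by simp
  then show False using fails \<psi>(2) by simp
qed

section \<open>Central steps in a minimal counterexample\<close>

lemma few_hits:
  assumes pre: "(step ^^ i) (V, E) (W1, \<phi>1)" and s: "splittable W1 \<phi>1 \<C> \<D> u v"
    and a: "a \<in> V" "\<forall>C\<in>\<C>. a \<in> C"
    and r: "(step ^^ j) (W1 \<union> {u, v}, split_by \<phi>1 \<C> \<D> u v) (W', \<phi>')" and k: "i + Suc j = k"
  shows "card {F \<in> \<phi>'. F \<inter> {a, u, v} \<noteq> {}} \<le> 2"
proof -
  have aV: "{a} \<subseteq> V" using a(1) by simp
  obtain m L' V' where m: "m \<le> i + j" "{a} \<union> {u, v} \<subseteq> L'"
    "(step ^^ m) (V - {a}, avoid {a} E) (V', avoid L' \<phi>')"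
    using steps_avoid_central[OF pre graphD(9) aV s _ a(2) r, of "V - {a}"] by blast
  \<comment> \<open>The price is that of the single vertex \<open>a\<close>, but \<open>u\<close>
    and \<open>v\<close> are deleted with it, so clauses at all three count as lost.\<close>
  have "int (card {F \<in> \<phi>'. F \<inter> {a, u, v} \<noteq> {}}) < 3 * (int (card {a}) - int (card ({} :: 'a set)))"
    by (rule lost_clauses[where m = m and V' = V' and \<psi> = "avoid L' \<phi>'"])
      (use m k a in \<open>auto simp: avoid_def\<close>)
  then show ?thesis by simp
qed

lemma central_structure:
  assumes pre: "(step ^^ i) (V, E) (W1, \<phi>1)" and s: "splittable W1 \<phi>1 \<C> \<D> u v"
    and a: "a \<in> V" "\<forall>C\<in>\<C>. a \<in> C"
    and r: "(step ^^ j) (W1 \<union> {u, v}, split_by \<phi>1 \<C> \<D> u v) (W', \<phi>')" and k: "i + Suc j = k"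
  shows "(\<forall>D\<in>\<D>. a \<in> D) \<or> (\<forall>D\<in>\<D>. a \<notin> D)" "\<forall>K\<in>\<phi>1. a \<in> K \<longrightarrow> K \<in> joins \<C> \<D>"
proof -
  have W1: "V \<subseteq> W1" "\<Union>\<phi>1 \<subseteq> W1" using steps_subset[OF pre graphD(9)] by auto
  have aW: "a \<in> W1" using a(1) W1(1) by blast
  obtain f g where "a \<in> g \<longrightarrow> (\<forall>D\<in>\<D>. a \<in> D)" "a \<notin> g \<longrightarrow> (\<forall>D\<in>\<D>. a \<notin> D)"
    "\<forall>K\<in>\<phi>1. a \<in> K \<longrightarrow> K \<in> joins \<C> \<D>"
    by (rule central_step_final[OF W1(2) s aW a(2) r fin few_hits[OF assms]])
  then show "(\<forall>D\<in>\<D>. a \<in> D) \<or> (\<forall>D\<in>\<D>. a \<notin> D)" "\<forall>K\<in>\<phi>1. a \<in> K \<longrightarrow> K \<in> joins \<C> \<D>"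
    by blast+
qed

lemma trivial_central_False:
  assumes pre: "(step ^^ i) (V, E) (W1, \<phi>1)" and s: "splittable W1 \<phi>1 \<C> \<D> u v"
    and a: "a \<in> V" and r: "(step ^^ j) (W1 \<union> {u, v}, split_by \<phi>1 \<C> \<D> u v) (W', \<phi>')"
    and k: "i + Suc j = k" and triv: "\<C> = {{a}}"
  shows False
proof -
  have W1: "V \<subseteq> W1" "\<Union>\<phi>1 \<subseteq> W1" using steps_subset[OF pre graphD(9)] by auto
  have aW: "a \<in> W1" using a W1(1) by blast
  have hits: "card {F \<in> \<phi>'. F \<inter> {a, u, v} \<noteq> {}} \<le> 2"
    by (rule few_hits[OF pre s a _ r k]) (simp add: triv)
  obtain m V' \<psi> where m: "m \<le> j" "(step ^^ m) (W1, \<phi>1) (V', \<psi>)" "finite \<psi>" "card \<psi> \<le> card \<phi>'"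
    using drop_central_step[OF W1(2) s[unfolded triv] aW r[unfolded triv] fin hits] by blast
  have st: "(step ^^ (i + m)) (V, E) (V', \<psi>)" using pre m(2) unfolding relpowp_add by blast
  have "3 * (i + m) + card V < 3 * k + card V" using m(1) k by simp
  from minimal[OF this graph neg st m(3)] show False using fails m(4) by simp
qed

lemma trivial_central_False_swapped:
  assumes pre: "(step ^^ i) (V, E) (W1, \<phi>1)" and s: "splittable W1 \<phi>1 \<C> \<D> u v"
    and a: "a \<in> V" and r: "(step ^^ j) (W1 \<union> {u, v}, split_by \<phi>1 \<C> \<D> u v) (W', \<phi>')"
    and k: "i + Suc j = k" and triv: "\<D> = {{a}}"
  shows False
proof (rule trivial_central_False[OF pre _ a _ k triv])
  show "splittable W1 \<phi>1 \<D> \<C> v u" using s splittable_commute by metis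
  show "(step ^^ j) (W1 \<union> {v, u}, split_by \<phi>1 \<D> \<C> v u) (W', \<phi>')"
    using r split_by_commute insert_commute by metis
qed

lemma undecided_central_False:
  assumes pre: "(step ^^ i) (V, E) (W1, \<phi>1)" and s: "splittable W1 \<phi>1 \<C> \<D> u v"
    and a: "a \<in> V" and U: "undecided a b \<phi>1" and c: "central a \<C> \<D>"
    and r: "(step ^^ j) (W1 \<union> {u, v}, split_by \<phi>1 \<C> \<D> u v) (W', \<phi>')" and k: "i + Suc j = k"
  shows False
proof -
  have *: False if s: "splittable W1 \<phi>1 \<C> \<D> u v" and c: "\<forall>C\<in>\<C>. a \<in> C"
    and r: "(step ^^ j) (W1 \<union> {u, v}, split_by \<phi>1 \<C> \<D> u v) (W', \<phi>')" for \<C> \<D> u v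
    using undecided_central_step[OF U s c central_structure[OF pre s a c r k]]
      trivial_central_False[OF pre s a r k] trivial_central_False_swapped[OF pre s a r k] by blast
  have s': "splittable W1 \<phi>1 \<D> \<C> v u" using s splittable_commute by metis
  have r': "(step ^^ j) (W1 \<union> {v, u}, split_by \<phi>1 \<D> \<C> v u) (W', \<phi>')"
    using r split_by_commute insert_commute by metis
  show False using c *[OF s _ r] *[OF s' _ r'] unfolding central_def by blast
qed

text \<open>Clauses of a graph have two vertices, so unless one side is \<open>{{a}}\<close> every
  join is the same edge \<open>{a, b}\<close>, and \<open>a\<close> is a leaf. It has a partner
  \<open>a'\<close>; deleting \<open>b\<close> and \<open>a'\<close> isolates \<open>a\<close> and
  loses three final clauses, traced from \<open>u\<close>, \<open>v\<close> and
  \<open>a'\<close>.\<close>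

lemma first_central_False:
  assumes s: "splittable V E \<C> \<D> u v" and c: "\<forall>C\<in>\<C>. a \<in> C"
    and r: "(step ^^ j) (V \<union> {u, v}, split_by E \<C> \<D> u v) (W', \<phi>')" and k: "Suc j = k"
  shows False
proof -
  have pre: "(step ^^ 0) (V, E) (V, E)" by simp
  have k': "0 + Suc j = k" using k by simp
  have uv: "u \<notin> V" "v \<notin> V" "u \<noteq> v" and ne: "\<C> \<noteq> {}" "\<D> \<noteq> {}" "{} \<notin> \<D>"
    using s unfolding splittable_def by auto
  note sub = splittable_subset[OF s graphD(9)]
  have aV: "a \<in> V" using ne(1) c sub(1) by blast
  note str = central_structure[OF pre s aV c r k']
  have two: "C \<union> D \<in> E" "card (C \<union> D) = 2" if "C \<in> \<C>" "D \<in> \<D>" for C D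
    using splittable_Un[OF s that] graphD(6) by auto
  have incl: "X \<subseteq> Y" if "card (X \<union> Y) = 2" "card Y = 2" for X Y :: "'a set"
  proof -
    have "finite (X \<union> Y)" using that(1) by (intro card_ge_0_finite) simp
    then have "Y = X \<union> Y" using that by (intro card_seteq) auto
    then show ?thesis by blast
  qed
  have "\<C> \<noteq> {{a}}" "\<D> \<noteq> {{a}}"
    using trivial_central_False[OF pre s aV r k'] trivial_central_False_swapped[OF pre s aV r k'] by auto
  then obtain C0 where C0: "C0 \<in> \<C>" "C0 \<noteq> {a}" using ne(1) by blast
  obtain b where b: "b \<in> C0" "b \<noteq> a" using C0 c by blast
  obtain D1 where D1: "D1 \<in> \<D>" using ne(2) by blast
  have "{a, b} \<subseteq> C0 \<union> D1" using C0(1) c b by blast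
  then have "C0 \<union> D1 \<subseteq> {a, b}"
    using incl[of "C0 \<union> D1" "{a, b}"] two(2)[OF C0(1) D1] b(2) by (metis Un_absorb2 card_2_iff)
  then have C0ab: "C0 = {a, b}" using C0(1) c b by blast
  have Dab: "D \<subseteq> {a, b}" if "D \<in> \<D>" for D
    using incl[of D C0] two(2)[OF C0(1) that] b(2) C0ab by (simp add: Un_commute)
  have ab: "{a, b} \<in> E" using two(1)[OF C0(1) D1] Dab[OF D1] C0ab by (metis Un_absorb2)
  obtain D0 where D0: "D0 \<in> \<D>" "b \<in> D0"
  proof -
    have "\<exists>D\<in>\<D>. b \<in> D"
    proof (rule ccontr)
      assume no: "\<not> ?thesis"
      have "D = {a}" if "D \<in> \<D>" for D
      proof -
        have "D \<subseteq> {a}" using no Dab[OF that] that by blast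
        then show ?thesis using ne(3) that subset_singletonD by metis
      qed
      then have "\<D> = {{a}}" using D1 by blast
      then show False using \<open>\<D> \<noteq> {{a}}\<close> by blast
    qed
    then show ?thesis using that by blast
  qed
  \<comment> \<open>If \<open>D\<close> lacks \<open>b\<close>, it is \<open>{a}\<close>. Then all
    of \<open>\<D>\<close> contains \<open>a\<close>, so \<open>D0\<close> is the whole edge and
    confines \<open>C\<close>.\<close>
  have all_ab: "C \<union> D = {a, b}" if CD: "C \<in> \<C>" "D \<in> \<D>" for C D
  proof -
    have "{a, b} \<subseteq> C \<union> D \<or> C \<union> D \<subseteq> {a, b}"
    proof (cases "b \<in> D")
      case True
      then show ?thesis using c CD by blast
    next
      case False
      have "D \<subseteq> {a}" using False Dab[OF CD(2)] by blast
      then have aD: "a \<in> D" using ne(3) CD(2) subset_singletonD by (metis singletonI)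
      then have "a \<in> D0" using str(1) CD(2) D0(1) by blast
      then have "D0 = {a, b}" using D0 Dab by blast
      then have "C \<subseteq> {a, b}" using incl[of C "{a, b}"] two(2)[OF CD(1) D0(1)] b(2) by simp
      then show ?thesis using Dab[OF CD(2)] by blast
    qed
    moreover have "card {a, b} = 2" using b(2) by simp
    moreover have "card (C \<union> D) = 2" using two(2)[OF CD] .
    ultimately show ?thesis by (metis card_seteq card.infinite finite.emptyI finite.insertI
          order_refl zero_neq_numeral)
  qed
  have leaf: "e = {a, b}" if "e \<in> E" "a \<in> e" for e
    using str(2) that all_ab unfolding joins_def by blast
  obtain a' where a': "{a, a'} \<in> P" using leaf_paired[OF ab leaf] .
  have a'V: "a' \<in> V" "a' \<noteq> a" using graphD(5,7)[OF a'] by auto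
  have "{a, b} \<notin> P" using paired_graph_pairs(2)[OF graph] ab by blast
  then have a'b: "a' \<noteq> b" using a' by metis
  have bV: "b \<in> V" using graphD(4)[OF ab] by simp
  obtain e where e: "e \<in> E" "a' \<in> e" using not_isolated[OF a'V(1)] .
  have ae: "a \<notin> e" using leaf[OF e(1)] e(2) a'V(2) a'b by blast
  have "e \<notin> joins \<C> \<D>" using all_ab ae unfolding joins_def by blast
  then have e': "e \<in> split_by E \<C> \<D> u v" using e(1) unfolding split_by_def by blast
  let ?W = "V \<union> {u, v}"
  have sub': "\<Union>(split_by E \<C> \<D> u v) \<subseteq> ?W" using sub graphD(9) unfolding split_by_def by blast
  have memu: "insert u C0 \<in> split_by E \<C> \<D> u v" and memv: "insert v D0 \<in> split_by E \<C> \<D> u v"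
    using C0(1) D0(1) unfolding split_by_def by blast+
  obtain F1 where F1: "F1 \<in> \<phi>'" "u \<in> F1" "F1 \<inter> ?W \<subseteq> insert u C0" using steps_trace[OF r sub' memu, of u] by blast
  obtain F2 where F2: "F2 \<in> \<phi>'" "v \<in> F2" "F2 \<inter> ?W \<subseteq> insert v D0" using steps_trace[OF r sub' memv, of v] by blast
  obtain F3 where F3: "F3 \<in> \<phi>'" "a' \<in> F3" "F3 \<inter> ?W \<subseteq> e" using steps_trace[OF r sub' e' e(2)] by blast
  have "v \<notin> F1" using F1(3) uv sub(1) C0(1) by blast
  moreover have "u \<notin> F3" "v \<notin> F3" using F3(3) uv graphD(4)[OF e(1)] by blast+
  ultimately have "card {F1, F2, F3} = 3" using F1(2) F2(2) by (auto simp: card_insert_if)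
  moreover have "int (card {F1, F2, F3}) < 3 * (int (card {b, a'}) - int (card {a}))"
  proof -
    let ?L = "{b, a'} \<union> {a}"
    have L: "?L \<subseteq> V" using bV a'V aV by auto
    obtain m L' V' where m: "m \<le> 0 + j" "?L \<union> {u, v} \<subseteq> L'"
      "(step ^^ m) (V - ?L, avoid ?L E) (V', avoid L' \<phi>')"
      using steps_avoid_central[OF pre graphD(9) L s _ c r, of "V - ?L"] by blast
    show ?thesis
    proof (rule lost_clauses[where m = m and V' = V' and \<psi> = "avoid L' \<phi>'"])
      fix e assume e: "e \<in> E \<union> P" "e \<inter> {a} \<noteq> {}"
      then have "e = {a, b} \<or> e = {a, a'}" using leaf pair_eq[OF _ a', of e a] by blast
      then show "e \<inter> {b, a'} \<noteq> {}" by blast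
    next
      have "F \<inter> L' \<noteq> {}" if "F \<in> {F1, F2, F3}" for F using that F1(2) F2(2) F3(2) m(2) by blast
      then show "{F1, F2, F3} \<inter> avoid L' \<phi>' = {}" unfolding avoid_def by blast
    qed (use L m k b a'V F1 F2 F3 in \<open>auto dest: subsetD[OF avoid_subset]\<close>)
  qed
  ultimately show False using a'b by simp
qed

section \<open>Reduction of the first step to a bipartite one\<close>

lemma swapped_step:
  assumes "splittable V E \<C> \<D> u v" "(step ^^ j) (V \<union> {u, v}, split_by E \<C> \<D> u v) (W', \<phi>')"
  shows "splittable V E \<D> \<C> v u" "(step ^^ j) (V \<union> {v, u}, split_by E \<D> \<C> v u) (W', \<phi>')"
proof -
  show "splittable V E \<D> \<C> v u" using assms(1) splittable_commute by metis
  show "(step ^^ j) (V \<union> {v, u}, split_by E \<D> \<C> v u) (W', \<phi>')"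
    using assms(2) split_by_commute insert_commute by metis
qed

lemma first_not_central:
  assumes s: "splittable V E \<C> \<D> u v"
    and r: "(step ^^ j) (V \<union> {u, v}, split_by E \<C> \<D> u v) (W', \<phi>')" and k: "Suc j = k"
  shows "\<not> central a \<C> \<D>"
  using first_central_False[OF s _ r k] first_central_False[OF swapped_step(1)[OF s r] _ swapped_step(2)[OF s r] k]
  unfolding central_def by blast

lemma first_non_singleton_False:
  assumes s: "splittable V E \<C> \<D> u v"
    and r: "(step ^^ j) (V \<union> {u, v}, split_by E \<C> \<D> u v) (W', \<phi>')" and k: "Suc j = k"
    and D0: "D0 \<in> \<D>" "\<And>x. D0 \<noteq> {x}"
  shows False
proof -
  have nc: "\<not> central x \<C> \<D>" for x using first_not_central[OF s r k] .
  have uv: "u \<notin> V" "v \<notin> V" "u \<noteq> v" and ne: "\<C> \<noteq> {}" "\<D> \<noteq> {}" "{} \<notin> \<C>" "{} \<notin> \<D>"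
    using s unfolding splittable_def by auto
  note sub = splittable_subset[OF s graphD(9)]
  have two: "C \<union> D \<in> E" "card (C \<union> D) = 2" if "C \<in> \<C>" "D \<in> \<D>" for C D
    using splittable_Un[OF s that] graphD(6) by auto
  obtain C0 where C0: "C0 \<in> \<C>" using ne(1) by blast
  obtain a where a: "a \<in> D0" using ne(4) D0(1) by (metis ex_in_conv)
  obtain b where b: "b \<in> D0" "b \<noteq> a" using D0(2)[of a] a by blast
  obtain y where y: "C0 \<union> D0 = {a, y}" using card_2_memE[OF two(2)[OF C0 D0(1)], of a] a by blast
  then have D0ab: "D0 = {a, b}" using a b by blast
  have Cab: "C \<subseteq> {a, b}" if C: "C \<in> \<C>" for C
  proof -
    obtain y where "C \<union> D0 = {a, y}" using card_2_memE[OF two(2)[OF C D0(1)], of a] a by blast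
    then show ?thesis using b by blast
  qed
  \<comment> \<open>All of \<open>\<C>\<close> lies in the edge \<open>{a, b}\<close>, so a clause
    lacking \<open>b\<close> is \<open>{a}\<close> and one lacking \<open>a\<close> is
    \<open>{b}\<close>; noncentrality supplies both.\<close>
  obtain Ca where Ca: "Ca \<in> \<C>" "b \<notin> Ca" using nc[of b] unfolding central_def by blast
  obtain Cb where Cb: "Cb \<in> \<C>" "a \<notin> Cb" using nc[of a] unfolding central_def by blast
  have "Ca \<subseteq> {a}" "Cb \<subseteq> {b}" using Cab[OF Ca(1)] Cab[OF Cb(1)] Ca(2) Cb(2) by blast+
  then have Cs: "{a} \<in> \<C>" "{b} \<in> \<C>" using Ca(1) Cb(1) ne(3) subset_singletonD by metis+
  have Dz: "D = {a, b} \<or> (\<exists>z. D = {z} \<and> z \<noteq> a \<and> z \<noteq> b)" if D: "D \<in> \<D>" for D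
  proof -
    obtain y where y: "{a} \<union> D = {a, y}" "y \<noteq> a" using card_2_memE[OF two(2)[OF Cs(1) D], of a] by blast
    obtain z where z: "{b} \<union> D = {b, z}" "z \<noteq> b" using card_2_memE[OF two(2)[OF Cs(2) D], of b] by blast
    show ?thesis
    proof (cases "a \<in> D")
      case True
      then have "a \<in> {b, z}" unfolding z(1)[symmetric] by simp
      then have "z = a" using b(2) by simp
      then have "D \<subseteq> {a, b}" using z(1) by (metis Un_upper2 insert_commute)
      moreover have "D \<noteq> {a}" using y by auto
      ultimately show ?thesis using True by blast
    next
      case False
      then have "D = {y}" using y by (metis insert_ident insert_is_Un singleton_insert_inj_eq singletonD)
      then show ?thesis using y z by auto
    qed
  qed
  have Ceq: "\<C> = {{a}, {b}}"
  proof -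
    \<comment> \<open>Beside \<open>{a, b}\<close> a singleton \<open>{z}\<close> would give a join
      of three vertices, so every \<open>D\<close> would be \<open>{a, b}\<close> and the step
      central.\<close>
    have "{a, b} \<notin> \<C>"
    proof
      assume "{a, b} \<in> \<C>"
      have "a \<in> D" if D: "D \<in> \<D>" for D
      proof (rule ccontr)
        assume "a \<notin> D"
        then obtain z where z: "D = {z}" "z \<noteq> a" "z \<noteq> b" using Dz[OF D] by blast
        then have "card ({a, b} \<union> D) = 3" using b(2) by auto
        then show False using two(2)[OF \<open>{a, b} \<in> \<C>\<close> D] by simp
      qed
      then show False using nc[of a] unfolding central_def by blast
    qed
    moreover have "C = {a} \<or> C = {b} \<or> C = {a, b}" if "C \<in> \<C>" for C
    proof -
      have "C \<noteq> {}" using ne(3) that by metis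
      then show ?thesis using Cab[OF that] by blast
    qed
    ultimately show ?thesis using Cs by blast
  qed
  define Z where "Z = {z. {z} \<in> \<D>}"
  have Zab: "a \<notin> Z" "b \<notin> Z" using Dz b(2) unfolding Z_def by (auto simp: doubleton_eq_iff)
  have Deq: "\<D> = insert {a, b} ((\<lambda>z. {z}) ` Z)"
    using Dz D0(1) D0ab unfolding Z_def by blast
  have Zne: "Z \<noteq> {}" using nc[of a] Deq unfolding central_def by auto
  let ?\<phi> = "split_by E \<C> \<D> u v"
  let ?j = "joins ((\<lambda>x. {x}) ` {a, b}) ((\<lambda>x. {x}) ` Z)"
  have jn: "joins \<C> \<D> = insert {a, b} ?j"
  proof -
    have "joins \<A> (insert X \<B>) = (\<lambda>Y. Y \<union> X) ` \<A> \<union> joins \<A> \<B>" for \<A> \<B> and X :: "'a set"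
      unfolding joins_def by blast
    moreover have "(\<lambda>Y. Y \<union> {a, b}) ` {{a}, {b}} = {{a, b}}" by auto
    ultimately show ?thesis unfolding Ceq Deq by simp
  qed
  have abj: "{a, b} \<notin> ?j" using Zab unfolding joins_def by (auto simp: doubleton_eq_iff)
  have ab: "{a, b} \<in> E" using two(1)[OF Cs(1) D0(1)] D0ab by (simp add: insert_commute)
  have abV: "a \<in> V" "b \<in> V" using graphD(4)[OF ab] by auto
  have abuv: "a \<noteq> u" "a \<noteq> v" "b \<noteq> u" "b \<noteq> v" using abV uv by auto
  have ZV: "z \<in> V" if "z \<in> Z" for z using that sub(2) unfolding Z_def by blast
  have in\<phi>: "K \<in> ?\<phi> \<longleftrightarrow> K \<in> E - insert {a, b} ?j \<or> K = {u, a} \<or> K = {u, b} \<or> K = {v, a, b} \<or> (\<exists>z\<in>Z. K = {v, z})" for K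
    unfolding split_by_def jn unfolding Ceq Deq by auto
  have E2: "K = {a, b}" if "K \<in> E" "a \<in> K" "b \<in> K" for K
    using card_2_memE[OF graphD(6)[OF that(1)] that(2)] that(3) b(2) by blast
  have onlyab: "K = {v, a, b}" if "K \<in> ?\<phi>" "a \<in> K" "b \<in> K" for K
    using that E2[of K] abuv b(2) Zab unfolding in\<phi> by blast
  \<comment> \<open>The only clause with both vertices is \<open>{v, a, b}\<close>, and the other
    clauses at \<open>v\<close> are \<open>{v, z}\<close> with \<open>z\<close> in \<open>Z\<close>,
    which contain neither.\<close>
  have U: "undecided a b ?\<phi>"
    unfolding undecided_def
  proof (intro conjI)
    have sm: "K \<notin> ?\<phi>" if "K \<subseteq> {a, b}" "K \<notin> E - {{a, b}}" for K
      using that abuv unfolding in\<phi> by blast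
    show "{a} \<notin> ?\<phi>" by (rule sm) (use graphD(6)[of "{a}"] in auto)
    show "{b} \<notin> ?\<phi>" by (rule sm) (use graphD(6)[of "{b}"] in auto)
    show "{a, b} \<notin> ?\<phi>" by (rule sm) auto
    show "\<exists>K\<in>?\<phi>. a \<in> K \<and> b \<in> K" by (rule bexI[of _ "{v, a, b}"]) (auto simp: in\<phi>)
    show "\<exists>K\<in>?\<phi>. a \<in> K \<and> b \<notin> K" using abuv b(2) by (intro bexI[of _ "{u, a}"]) (auto simp: in\<phi>)
    show "\<exists>K\<in>?\<phi>. b \<in> K \<and> a \<notin> K" using abuv b(2) by (intro bexI[of _ "{u, b}"]) (auto simp: in\<phi>)
    have "a \<in> K' \<longleftrightarrow> b \<in> K'" if K': "K' \<in> ?\<phi>" "v \<in> K'" for K'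
    proof -
      have "K' \<notin> E" using K'(2) uv graphD(4) by blast
      then show ?thesis using K' abuv uv(3) Zab unfolding in\<phi> by auto
    qed
    then show "\<forall>K\<in>?\<phi>. \<forall>K'\<in>?\<phi>. \<forall>x. a \<in> K \<and> b \<in> K \<and> x \<in> K \<and> x \<noteq> a \<and> x \<noteq> b \<and> x \<in> K' \<longrightarrow>
        (a \<in> K' \<longleftrightarrow> b \<in> K')"
      using onlyab by blast
  qed
  have s': "splittable V E ((\<lambda>x. {x}) ` {a, b}) ((\<lambda>x. {x}) ` Z) u v"
    using s Zne uv jn unfolding splittable_def by auto
  have dec: "decide a b ?\<phi> = split_by E ((\<lambda>x. {x}) ` {a, b}) ((\<lambda>x. {x}) ` Z) u v"
  proof (rule set_eqI)
    fix K
    have R: "K \<in> split_by E ((\<lambda>x. {x}) ` {a, b}) ((\<lambda>x. {x}) ` Z) u v \<longleftrightarrow>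
        K \<in> E - ?j \<or> K = {u, a} \<or> K = {u, b} \<or> (\<exists>z\<in>Z. K = {v, z})"
      unfolding split_by_def by auto
    have L: "K \<in> decide a b ?\<phi> \<longleftrightarrow> K = {a, b} \<or> K \<in> ?\<phi> \<and> \<not> (a \<in> K \<and> b \<in> K)"
      unfolding decide_def by blast
    show "K \<in> decide a b ?\<phi> \<longleftrightarrow> K \<in> split_by E ((\<lambda>x. {x}) ` {a, b}) ((\<lambda>x. {x}) ` Z) u v"
      unfolding L R
    proof (cases "a \<in> K \<and> b \<in> K")
      case True
      have "K \<noteq> {u, a}" "K \<noteq> {u, b}" "\<forall>z\<in>Z. K \<noteq> {v, z}" using True abuv b(2) Zab by auto
      then show "(K = {a, b} \<or> K \<in> ?\<phi> \<and> \<not> (a \<in> K \<and> b \<in> K)) =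
          (K \<in> E - ?j \<or> K = {u, a} \<or> K = {u, b} \<or> (\<exists>z\<in>Z. K = {v, z}))"
        using True ab abj E2[of K] by auto
    next
      case False
      then show "(K = {a, b} \<or> K \<in> ?\<phi> \<and> \<not> (a \<in> K \<and> b \<in> K)) =
          (K \<in> E - ?j \<or> K = {u, a} \<or> K = {u, b} \<or> (\<exists>z\<in>Z. K = {v, z}))"
        unfolding in\<phi> by auto
    qed
  qed
  have sub': "\<Union>?\<phi> \<subseteq> V \<union> {u, v}" using sub graphD(9) unfolding split_by_def by blast
  have jk: "j < k" using k by simp
  consider (decided) "undecided a b \<phi>'" "(step ^^ j) (V \<union> {u, v}, decide a b ?\<phi>) (W', decide a b \<phi>')"
    | (central) i l W1 \<phi>1 \<C>1 \<D>1 u1 v1 where "j = i + Suc l" "(step ^^ i) (V \<union> {u, v}, ?\<phi>) (W1, \<phi>1)"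
      "undecided a b \<phi>1" "splittable W1 \<phi>1 \<C>1 \<D>1 u1 v1" "central a \<C>1 \<D>1 \<or> central b \<C>1 \<D>1"
      "(step ^^ l) (W1 \<union> {u1, v1}, split_by \<phi>1 \<C>1 \<D>1 u1 v1) (W', \<phi>')"
    using undecided_steps[OF r U _ _ sub'] abV by auto
  then show False
  proof cases
    case decided
    then show False
      using clean_step_False[OF s' _ card_decide_le[OF decided(1) fin] jk] unfolding dec by blast
  next
    case central
    have pre: "(step ^^ Suc i) (V, E) (W1, \<phi>1)" by (rule relpowp_Suc_I2[OF stepI[OF s] central(2)])
    have k': "Suc i + Suc l = k" using central(1) k by simp
    have U': "undecided b a \<phi>1" using central(3) undecided_commute by metis
    show False
      using central(5) undecided_central_False[OF pre central(4) abV(1) central(3) _ central(6) k']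
        undecided_central_False[OF pre central(4) abV(2) U' _ central(6) k'] by blast
  qed
qed

lemma contradiction: False
proof -
  obtain j where j: "Suc j = k" using steps_nonempty not0_implies_Suc by metis
  then obtain t where t: "step (V, E) t" "(step ^^ j) t (W', \<phi>')"
    using relpowp_Suc_D2[of j step "(V, E)" "(W', \<phi>')"] steps by auto
  from t(1) obtain \<C> \<D> u v where s: "splittable V E \<C> \<D> u v"
    and "t = (V \<union> {u, v}, split_by E \<C> \<D> u v)" by (auto elim: stepE)
  with t(2) have r: "(step ^^ j) (V \<union> {u, v}, split_by E \<C> \<D> u v) (W', \<phi>')" by simp
  have D: "\<exists>x. D = {x}" if "D \<in> \<D>" for D
    using first_non_singleton_False[OF s r j that] by blast
  have C: "\<exists>x. C = {x}" if "C \<in> \<C>" for C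
    using first_non_singleton_False[OF swapped_step[OF s r] j that] by blast
  have "\<C> = (\<lambda>x. {x}) ` {x. {x} \<in> \<C>}" "\<D> = (\<lambda>x. {x}) ` {x. {x} \<in> \<D>}" using C D by blast+
  then show False using clean_step_False[of "{x. {x} \<in> \<C>}" "{x. {x} \<in> \<D>}" u v j] s r fin j by (metis lessI order_refl)
qed

end

theorem card_steps_ge:
  assumes "paired_graph V E P" "neg_dim E P d" "(step ^^ k) (V, E) (W', \<phi>')" "finite \<phi>'"
  shows "3 * (2 * int d - int (card V)) \<le> int (card \<phi>')"
  using assms
proof (induction "3 * k + card V" arbitrary: V E P d k W' \<phi>' rule: less_induct)
  case less
  show ?case
  proof (rule ccontr)
    assume f: "\<not> ?case"
    interpret minimal_counterexample V E P d k W' \<phi>'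
    proof
      show "int (card \<phi>') < 3 * (2 * int d - int (card V))" using f by simp
    qed (use less in auto)
    show False by (rule contradiction)
  qed
qed

section \<open>Formulas\<close>

text \<open>Both polarities of every variable, so that a fresh variable provides two fresh
  vertices.\<close>

definition literals :: "'v literal set set \<Rightarrow> 'v literal set" where
  "literals \<phi> = {l. var_of l \<in> Var \<phi>}"

lemma clause_join_eq_joins: "\<C> \<bowtie> \<D> = joins \<C> \<D>"
  unfolding clause_join_def joins_def ..

text \<open>A step with \<open>\<C>\<close> or \<open>\<D>\<close> empty only adds clauses containing a fresh literal; ignoring
  the clauses with such literals turns a BVA derivation into one with proper steps.\<close>

lemma bva_steps_imp_steps:
  assumes "\<phi>0 \<Rightarrow>\<^sup>*\<^sub>B\<^sub>V\<^sub>A \<phi>"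
  shows "\<exists>n L W. (step ^^ n) (literals \<phi>0, \<phi>0) (W, avoid L \<phi>) \<and> W \<subseteq> literals \<phi> \<and> L \<subseteq> literals \<phi>"
  using assms
proof (induction rule: rtranclp_induct)
  case base
  have "(step ^^ 0) (literals \<phi>0, \<phi>0) (literals \<phi>0, avoid {} \<phi>0)" unfolding avoid_def by simp
  then show ?case by blast
next
  case (step \<phi> \<phi>')
  then obtain n L W where IH: "(step ^^ n) (literals \<phi>0, \<phi>0) (W, avoid L \<phi>)"
    "W \<subseteq> literals \<phi>" "L \<subseteq> literals \<phi>" by blast
  from step.hyps(2) obtain \<C> \<D> y where ne: "\<forall>C\<in>\<C>. is_clause C \<and> C \<noteq> {}" "\<forall>D\<in>\<D>. is_clause D \<and> D \<noteq> {}"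
    and sub: "joins \<C> \<D> \<subseteq> \<phi>" and y: "y \<notin> Var \<phi>"
    and \<phi>': "\<phi>' = (\<phi> - joins \<C> \<D>) \<union> {C \<union> {Pos y} | C. C \<in> \<C>} \<union> {{Neg y} \<union> D | D. D \<in> \<D>}"
    unfolding bva_step_def clause_join_eq_joins by (elim conjE exE)
  have "{C \<union> {Pos y} | C. C \<in> \<C>} = insert (Pos y) ` \<C>" "{{Neg y} \<union> D | D. D \<in> \<D>} = insert (Neg y) ` \<D>"
    by auto
  then have split: "\<phi>' = split_by \<phi> \<C> \<D> (Pos y) (Neg y)" unfolding \<phi>' split_by_def by simp
  have fresh: "Pos y \<notin> literals \<phi>" "Neg y \<notin> literals \<phi>" using y unfolding literals_def by auto
  have fresh': "Pos y \<notin> \<Union>\<phi>" "Neg y \<notin> \<Union>\<phi>" using y unfolding Var_def by force+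
  show ?case
  \<comment> \<open>With both sides empty, \<open>y\<close> does not enter \<open>\<phi>'\<close>
    and stays available later, so its literals must not be counted as used.\<close>
  proof (cases "\<C> = {} \<and> \<D> = {}")
    case True
    then have "\<phi>' = \<phi>" unfolding split split_by_def joins_def by simp
    then show ?thesis using IH by blast
  next
    case False
    have "Var \<phi> \<subseteq> Var \<phi>'"
    proof
      fix z assume "z \<in> Var \<phi>"
      then obtain K l where l: "K \<in> \<phi>" "l \<in> K" "z = var_of l" unfolding Var_def by blast
      have "\<exists>K'\<in>\<phi>'. l \<in> K'"
      proof (cases "K \<in> joins \<C> \<D>")
        case True
        then obtain C D where "C \<in> \<C>" "D \<in> \<D>" "K = C \<union> D" unfolding joins_def by blast
        then have "insert (Pos y) C \<in> \<phi>'" "insert (Neg y) D \<in> \<phi>'" "l \<in> C \<or> l \<in> D"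
          using l(2) unfolding split split_by_def by auto
        then show ?thesis by (metis insertCI)
      next
        case False
        then show ?thesis using l unfolding split split_by_def by blast
      qed
      then show "z \<in> Var \<phi>'" using l(3) unfolding Var_def by blast
    qed
    moreover have "y \<in> Var \<phi>'"
    proof -
      have "\<exists>l\<in>\<Union>\<phi>'. y = var_of l"
      proof (cases "\<C> = {}")
        case True
        then obtain D where "insert (Neg y) D \<in> \<phi>'" using False unfolding split split_by_def by auto
        then show ?thesis by (intro bexI[of _ "Neg y"]) auto
      next
        case False
        then obtain C where "insert (Pos y) C \<in> \<phi>'" unfolding split split_by_def by auto
        then show ?thesis by (intro bexI[of _ "Pos y"]) auto
      qed
      then show ?thesis unfolding Var_def by blast
    qed
    ultimately have lit: "literals \<phi> \<union> {Pos y, Neg y} \<subseteq> literals \<phi>'" unfolding literals_def by auto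
    show ?thesis
    proof (cases "avoid L \<C> = {} \<or> avoid L \<D> = {}")
      case True
      have "avoid (L \<union> {Pos y, Neg y}) \<phi>' = avoid L \<phi>"
        unfolding split by (rule avoid_split_by_degenerate[OF fresh' True])
      then have "(step ^^ n) (literals \<phi>0, \<phi>0) (W, avoid (L \<union> {Pos y, Neg y}) \<phi>')" using IH(1) by simp
      moreover have "W \<subseteq> literals \<phi>'" "L \<union> {Pos y, Neg y} \<subseteq> literals \<phi>'" using IH(2,3) lit by auto
      ultimately show ?thesis by blast
    next
      case nonempty: False
      then have "\<C> \<noteq> {}" "\<D> \<noteq> {}" unfolding avoid_def by auto
      then have "splittable W \<phi> \<C> \<D> (Pos y) (Neg y)"
        using ne sub fresh IH(2) unfolding splittable_def by auto
      then have "splittable W (avoid L \<phi>) (avoid L \<C>) (avoid L \<D>) (Pos y) (Neg y)"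
        using nonempty by (intro splittable_avoid) auto
      moreover have "avoid L \<phi>' = split_by (avoid L \<phi>) (avoid L \<C>) (avoid L \<D>) (Pos y) (Neg y)"
        unfolding split using fresh IH(3) by (intro avoid_split_by) auto
      ultimately have "step (W, avoid L \<phi>) (W \<union> {Pos y, Neg y}, avoid L \<phi>')"
        using stepI by metis
      then have "(step ^^ Suc n) (literals \<phi>0, \<phi>0) (W \<union> {Pos y, Neg y}, avoid L \<phi>')"
        using IH(1) by auto
      moreover have "W \<union> {Pos y, Neg y} \<subseteq> literals \<phi>'" "L \<subseteq> literals \<phi>'" using IH(2,3) lit by auto
      ultimately show ?thesis by blast
    qed
  qed
qed

lemma AtMostOne_eq_pairs:
  assumes "inj_on x {1..n}"
  shows "AtMostOne x n = {e. e \<subseteq> (\<lambda>i. Neg (x i)) ` {1..n} \<and> card e = 2}"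
proof (intro equalityI subsetI)
  fix e assume "e \<in> AtMostOne x n"
  then obtain i j where ij: "e = {Neg (x i), Neg (x j)}" "1 \<le> i" "i < j" "j \<le> n"
    unfolding AtMostOne_def by blast
  then have "x i \<noteq> x j" using inj_onD[OF assms, of i j] by auto
  then have "card e = 2" using ij(1) by simp
  then show "e \<in> {e. e \<subseteq> (\<lambda>i. Neg (x i)) ` {1..n} \<and> card e = 2}" using ij by auto
next
  fix e assume e: "e \<in> {e. e \<subseteq> (\<lambda>i. Neg (x i)) ` {1..n} \<and> card e = 2}"
  then obtain l m where lm: "e = {l, m}" "l \<noteq> m" by (auto simp: card_2_iff)
  then have "l \<in> (\<lambda>i. Neg (x i)) ` {1..n}" "m \<in> (\<lambda>i. Neg (x i)) ` {1..n}" using e by auto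
  then obtain i j where ij: "l = Neg (x i)" "m = Neg (x j)" "i \<in> {1..n}" "j \<in> {1..n}" by blast
  have "i < j \<or> j < i" using lm(2) ij by (metis linorder_neqE_nat)
  then show "e \<in> AtMostOne x n"
  proof
    assume "i < j"
    then show ?thesis using lm(1) ij unfolding AtMostOne_def by auto
  next
    assume "j < i"
    moreover have "e = {Neg (x j), Neg (x i)}" using lm(1) ij by blast
    ultimately show ?thesis using ij unfolding AtMostOne_def by auto
  qed
qed

theorem theorem28:
  fixes x :: "nat \<Rightarrow> 'v" and n :: nat and \<phi> :: "'v literal set set"
  assumes "inj_on x {1..n}"
    and "is_formula \<phi>"
    and "AtMostOne x n \<Rightarrow>\<^sup>*\<^sub>B\<^sub>V\<^sub>A \<phi>"
  shows "int (card \<phi>) \<ge> 3 * int n - 6"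
\<comment> \<open>The bound is not positive here. Otherwise every vertex lies on an edge, so
  \<open>V\<close> consists of literals of the formula.\<close>
proof (cases "n \<le> 2")
  case True
  then show ?thesis by simp
next
  case False
  define V where "V = (\<lambda>i. Neg (x i)) ` {1..n}"
  let ?E = "AtMostOne x n"
  have E: "?E = {e. e \<subseteq> V \<and> card e = 2}" unfolding V_def by (rule AtMostOne_eq_pairs[OF assms(1)])
  have "inj_on (\<lambda>i. Neg (x i)) {1..n}" by (rule inj_onI) (metis literal.inject(2) inj_onD[OF assms(1)])
  then have cV: "card V = n" unfolding V_def by (simp add: card_image)
  have fV: "finite V" unfolding V_def by simp
  have "\<exists>I. (\<forall>e\<in>?E. \<not> e \<subseteq> I)" by (rule exI[of _ "{}"]) (auto simp: E)
  then have graph: "paired_graph V ?E {}" unfolding paired_graph_def using fV E by simp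
  have neg: "neg_dim ?E {} (n - 1)" unfolding E using neg_dim_complete[OF fV] cV by simp
  obtain k L W where st: "(step ^^ k) (literals ?E, ?E) (W, avoid L \<phi>)"
    using bva_steps_imp_steps[OF assms(3)] by blast
  have "V \<subseteq> literals ?E"
  proof
    fix l assume l: "l \<in> V"
    have "\<not> V \<subseteq> {l}" using card_mono[of "{l}" V] cV False by auto
    then obtain m where "m \<in> V" "m \<noteq> l" by blast
    then have "{l, m} \<in> ?E" unfolding E using l by auto
    then show "l \<in> literals ?E" unfolding literals_def Var_def by blast
  qed
  then obtain W' where "(step ^^ k) (V, ?E) (W', avoid L \<phi>)" using steps_weaken[OF st] by blast
  moreover have fin: "finite \<phi>" using assms(2) unfolding is_formula_def by simp
  then have "finite (avoid L \<phi>)" unfolding avoid_def by simp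
  ultimately have "3 * (2 * int (n - 1) - int (card V)) \<le> int (card (avoid L \<phi>))"
    by (rule card_steps_ge[OF graph neg])
  moreover have "card (avoid L \<phi>) \<le> card \<phi>" using card_mono[OF fin avoid_subset] .
  ultimately show ?thesis using cV False by simp
qed

end
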